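(* Let $G_3$ be the group described in the context, and let $\sigma,\rho$ be the automorphisms of $G_3$ determined by $a_i^\sigma=b_i$, $b_i^\sigma=a_i$, $u_{ij}^\sigma=v_{ij}$, $v_{ij}^\sigma=u_{ij}$, $p_{ij}^\sigma=p_{ij}$, $z_{123}^\sigma=t_{123}$, $t_{123}^\sigma=z_{123}$, and $a_i^\rho=b_i$, $b_i^\rho=a_i^{-1}b_i^{-1}$, $u_{ij}^\rho=v_{ij}$, $v_{ij}^\rho=u_{ij}v_{ij}$, $p_{ij}^\rho=v_{ij}p_{ij}$, $z_{123}^\rho=t_{123}$, $t_{123}^\rho=z_{123}t_{123}$. Then $G_3$ is a group with triality $S=\langle\sigma,\rho\rangle$.
   Context: For a group, $[x,y]=x^{-1}y^{-1}xy$. $G_3$ is the nilpotent group of class $3$ generated by $a_1,a_2,a_3,b_1,b_2,b_3$ with the following defining relations, where $u_{ij}=[a_i,a_j]$, $v_{ij}=[b_i,b_j]$, $p_{ij}=[a_i,b_j]$, indices in $\{1,2,3\}$: (1) $[a_i,b_i]=1$ and $a_i^2,b_i^2$ are central; (2) for $i<j$: $u_{ij}=u_{ji}$, $v_{ij}=v_{ji}$, $u_{ij}^2=v_{ij}^2=1$; (3) $u_{ij},v_{ij}$ central; (4) $p_{ij}=p_{ji}$, $p_{ij}^2=1$ for $i<j$; (5) for $\{i,j,k\}=\{1,2,3\}$, $z_{ijk}:=[p_{ij},a_k]$ with $z_{ijk}=z_{jik}=z_{kij}$; (6) $t_{ijk}:=[p_{ij},b_k]$ with $t_{ijk}=t_{jik}=t_{kij}$;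 (7) $z_{ijk}^2=t_{ijk}^2=1$; (8) $z_{ijk},t_{ijk}$ central. A group with triality is a group $G$ together with a subgroup $S$ of $\mathrm{Aut}(G)$ with $S=\langle\sigma,\rho\mid\sigma^2=\rho^3=(\sigma\rho)^2=1\rangle\cong S_3$ such that for every $g\in G$, $[g,\sigma]\,[g,\sigma]^{\rho}\,[g,\sigma]^{\rho^2}=1$, where $[g,\sigma]=g^{-1}g^{\sigma}$ and $x^\rho$ denotes the image of $x$ under $\rho$. *)

theory Defs
  imports "HOL-Algebra.Algebra"
begin

datatype ix = X1 | X2 | X3

fun ixn :: "ix \<Rightarrow> nat" where
  "ixn X1 = 1" | "ixn X2 = 2" | "ixn X3 = 3"

datatype gen = GA ix | GB ix

text \<open>Words in the free group on the six generators a_1,a_2,a_3,b_1,b_2,b_3;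
  a letter (x, False) stands for x, a letter (x, True) for x inverse.\<close>
type_synonym word = "(gen \<times> bool) list"

definition winv :: "word \<Rightarrow> word" where
  "winv w = rev (map (\<lambda>(x, e). (x, \<not> e)) w)"

definition wcomm :: "word \<Rightarrow> word \<Rightarrow> word" where
  "wcomm x y = winv x @ winv y @ x @ y"

definition wa :: "ix \<Rightarrow> word" where "wa i = [(GA i, False)]"
definition wb :: "ix \<Rightarrow> word" where "wb i = [(GB i, False)]"
definition wu :: "ix \<Rightarrow> ix \<Rightarrow> word" where "wu i j = wcomm (wa i) (wa j)"
definition wv :: "ix \<Rightarrow> ix \<Rightarrow> word" where "wv i j = wcomm (wb i) (wb j)"
definition wp :: "ix \<Rightarrow> ix \<Rightarrow> word" where "wp i j = wcomm (wa i) (wb j)"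
definition wz :: "ix \<Rightarrow> ix \<Rightarrow> ix \<Rightarrow> word" where "wz i j k = wcomm (wp i j) (wa k)"
definition wt :: "ix \<Rightarrow> ix \<Rightarrow> ix \<Rightarrow> word" where "wt i j k = wcomm (wp i j) (wb k)"

definition wgens :: "word set" where
  "wgens = {wa i | i. True} \<union> {wb i | i. True}"

definition central_rels :: "word \<Rightarrow> (word \<times> word) set" where
  "central_rels w = {(wcomm w x, []) | x. x \<in> wgens}"

definition distinct3 :: "ix \<Rightarrow> ix \<Rightarrow> ix \<Rightarrow> bool" where
  "distinct3 i j k \<longleftrightarrow> i \<noteq> j \<and> j \<noteq> k \<and> i \<noteq> k"

definition G3_rels :: "(word \<times> word) set" where
  "G3_rels =
     \<comment> \<open>(1)\<close>
     {(wcomm (wa i) (wb i), []) | i. True}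
   \<union> (\<Union>i. central_rels (wa i @ wa i)) \<union> (\<Union>i. central_rels (wb i @ wb i))
     \<comment> \<open>(2)\<close>
   \<union> {(wu i j, wu j i) | i j. ixn i < ixn j} \<union> {(wv i j, wv j i) | i j. ixn i < ixn j}
   \<union> {(wu i j @ wu i j, []) | i j. ixn i < ixn j} \<union> {(wv i j @ wv i j, []) | i j. ixn i < ixn j}
     \<comment> \<open>(3)\<close>
   \<union> (\<Union>i j. central_rels (wu i j)) \<union> (\<Union>i j. central_rels (wv i j))
     \<comment> \<open>(4)\<close>
   \<union> {(wp i j, wp j i) | i j. ixn i < ixn j} \<union> {(wp i j @ wp i j, []) | i j. ixn i < ixn j}
     \<comment> \<open>(5), (6)\<close>
   \<union> {(wz i j k, wz j i k) | i j k. distinct3 i j k} \<union> {(wz i j k, wz k i j) | i j k. distinct3 i j k}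
   \<union> {(wt i j k, wt j i k) | i j k. distinct3 i j k} \<union> {(wt i j k, wt k i j) | i j k. distinct3 i j k}
     \<comment> \<open>(7)\<close>
   \<union> {(wz i j k @ wz i j k, []) | i j k. distinct3 i j k} \<union> {(wt i j k @ wt i j k, []) | i j k. distinct3 i j k}
     \<comment> \<open>(8)\<close>
   \<union> (\<Union>i j k. if distinct3 i j k then central_rels (wz i j k) \<union> central_rels (wt i j k) else {})"

inductive G3_eqv :: "word \<Rightarrow> word \<Rightarrow> bool" where
  refl: "G3_eqv w w"
| sym: "G3_eqv v w \<Longrightarrow> G3_eqv w v"
| trans: "G3_eqv u v \<Longrightarrow> G3_eqv v w \<Longrightarrow> G3_eqv u w"
| cancel: "G3_eqv (u @ [(x, e), (x, \<not> e)] @ v) (u @ v)"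
| rel: "(l, r) \<in> G3_rels \<Longrightarrow> G3_eqv (u @ l @ v) (u @ r @ v)"

definition G3_class :: "word \<Rightarrow> word set" where
  "G3_class w = {v. G3_eqv w v}"

definition G3_mult :: "word set \<Rightarrow> word set \<Rightarrow> word set" where
  "G3_mult P Q = G3_class (SOME r. \<exists>p\<in>P. \<exists>q\<in>Q. r = p @ q)"

definition G3 :: "word set monoid" where
  "G3 = \<lparr> carrier = range G3_class, monoid.mult = G3_mult, one = G3_class [] \<rparr>"

abbreviation "ga i \<equiv> G3_class (wa i)"
abbreviation "gb i \<equiv> G3_class (wb i)"
abbreviation "gu i j \<equiv> G3_class (wu i j)"
abbreviation "gv i j \<equiv> G3_class (wv i j)"
abbreviation "gp i j \<equiv> G3_class (wp i j)"
abbreviation "gz i j k \<equiv> G3_class (wz i j k)"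
abbreviation "gt i j k \<equiv> G3_class (wt i j k)"

text \<open>Automorphisms act on the right: x^\<sigma> = \<sigma> x, and x^(\<sigma>\<rho>) = \<rho> (\<sigma> x),
  which in AutoGroup (composition g \<otimes> f = g \<circ> f) is \<rho> \<otimes> \<sigma>.
  S = \<langle>\<sigma>,\<rho> | \<sigma>^2 = \<rho>^3 = (\<sigma>\<rho>)^2 = 1\<rangle> \<cong> S_3 is rendered as: the relations hold
  in Aut(G) and the subgroup of Aut(G) generated by \<sigma>, \<rho> is isomorphic to S_3.\<close>
definition group_with_triality ::
    "('a, 'b) monoid_scheme \<Rightarrow> ('a \<Rightarrow> 'a) \<Rightarrow> ('a \<Rightarrow> 'a) \<Rightarrow> bool" where
  "group_with_triality G \<sigma> \<rho> \<longleftrightarrow>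
     group G \<and> \<sigma> \<in> auto G \<and> \<rho> \<in> auto G \<and>
     \<sigma> [^]\<^bsub>AutoGroup G\<^esub> (2::nat) = \<one>\<^bsub>AutoGroup G\<^esub> \<and>
     \<rho> [^]\<^bsub>AutoGroup G\<^esub> (3::nat) = \<one>\<^bsub>AutoGroup G\<^esub> \<and>
     (\<rho> \<otimes>\<^bsub>AutoGroup G\<^esub> \<sigma>) [^]\<^bsub>AutoGroup G\<^esub> (2::nat) = \<one>\<^bsub>AutoGroup G\<^esub> \<and>
     subgroup_generated (AutoGroup G) {\<sigma>, \<rho>} \<cong> sym_group 3 \<and>
     (\<forall>g \<in> carrier G.
        let c = inv\<^bsub>G\<^esub> g \<otimes>\<^bsub>G\<^esub> \<sigma> g in
        c \<otimes>\<^bsub>G\<^esub> \<rho> c \<otimes>\<^bsub>G\<^esub> \<rho> (\<rho> c) = \<one>\<^bsub>G\<^esub>)"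

end

(* The defining relations are exactly the rules needed to collect words: every element is a product
   of powers of a_1, a_2, a_3, b_1, b_2, b_3, p_ij, u_ij, v_ij, z, t in this order, and the exponents
   of a product of two such elements are integer polynomials in the exponents of the factors, those
   of the commutators p_ij, u_ij, v_ij, z, t mattering only modulo 2. A short collection shows that
   both (b_i, a_i) and (b_i, a_i^-1 b_i^-1) satisfy the defining relations, so sigma and rho exist as
   endomorphisms, and the relations of S_3 are checked on generators. The triality identity becomes
   an identity of exponent polynomials; the commutator [g, sigma] is handled as the solution of
   g [g, sigma] = g^sigma, which can be read off degree by degree. Finally rho and sigma are
   nontrivial because the exponent sum in the a_i is an invariant, and nontrivial elements of orders
   3 and 2 subject to the relations of S_3 generate a copy of S_3. *)
theory Submission
  imports Defs
begin

section \<open>Commutators and integer multiples in additive groups\<close>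

text \<open>Class \<^class>\<open>group_add\<close> does not assume commutativity. Groups are written additively below,
  in order to work with a type class instead of carrier sets; products become sums.\<close>

definition commutes :: "'a::group_add \<Rightarrow> 'a \<Rightarrow> bool" where
  "commutes x y \<longleftrightarrow> x + y = y + x"

definition comm :: "'a::group_add \<Rightarrow> 'a \<Rightarrow> 'a" where
  "comm x y = - x + - y + x + y"

definition zmul :: "int \<Rightarrow> 'a::group_add \<Rightarrow> 'a" where
  "zmul n x = (if 0 \<le> n then (((+) x) ^^ nat n) 0 else - (((+) x) ^^ nat (- n)) 0)"

\<comment> \<open>Differences hide the inverse letters on which the rewriting of words operates.\<close>
declare add_uminus_conv_diff [simp del]

lemmas group_simps = diff_conv_add_uminus minus_add add.assoc

lemma commutes_refl: "commutes x x"
  by (simp add: commutes_def)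

lemma commutes_sym: "commutes x y \<Longrightarrow> commutes y x"
  by (simp add: commutes_def)

lemma commutes_0: "commutes 0 x" "commutes x 0"
  by (simp_all add: commutes_def)

lemma commutes_left: "commutes x y \<Longrightarrow> x + (y + z) = y + (x + z)"
  by (simp add: commutes_def flip: add.assoc)

lemma commutes_add: "commutes x y \<Longrightarrow> commutes x z \<Longrightarrow> commutes x (y + z)"
  using commutes_left[of x y z] by (simp add: commutes_def add.assoc)

lemma commutes_minus:
  assumes "commutes x y"
  shows "commutes x (- y)"
proof -
  have "x + - y = - y + (y + x) + - y"
    by (simp add: add.assoc)
  also have "\<dots> = - y + x"
    by (simp add: add.assoc flip: assms[unfolded commutes_def])
  finally show ?thesis
    by (simp add: commutes_def)
qed

lemma commutes_comm: "commutes x y \<Longrightarrow> commutes x z \<Longrightarrow> commutes x (comm y z)"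
  unfolding comm_def by (intro commutes_add commutes_minus)

lemma add_eq_add_comm: "x + y = y + x + comm x y"
  by (simp add: comm_def group_simps)

lemma comm_eq_0_iff: "comm x y = 0 \<longleftrightarrow> commutes x y"
  using add_left_cancel[of "y + x" "comm x y" 0] by (simp add: commutes_def add_eq_add_comm[of x y])

lemma commI: "x + y = y + x + c \<Longrightarrow> comm x y = c"
  using add_eq_add_comm add_left_cancel by metis

lemma minus_comm: "- comm x y = comm y x"
  by (simp add: comm_def minus_add add.assoc)

lemma comm_conj: "- g + comm x y + g = comm (- g + x + g) (- g + y + g)"
  by (simp add: comm_def group_simps)

lemma comm_add_left:
  assumes "commutes c x" "commutes c y"
  shows "comm (x + c) y = comm x y"
proof (rule commI)
  have "x + c + y = x + y + c"
    using assms(2) by (simp add: commutes_def add.assoc)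
  also have "\<dots> = y + x + (comm x y + c)"
    using add_eq_add_comm[of x y] by (simp add: add.assoc)
  also have "\<dots> = y + (x + c) + comm x y"
    using commutes_comm[OF assms] by (simp add: commutes_def add.assoc)
  finally show "x + c + y = y + (x + c) + comm x y" .
qed

lemma comm_add_right:
  assumes "commutes c x" "commutes c y"
  shows "comm x (y + c) = comm x y"
  using comm_add_left[OF assms(2,1)] by (simp flip: minus_comm[of x])

text \<open>Supplies commutations that the relations do not list: p_ij with a_i, a_j, b_i and b_j,
  and the p_ij among themselves.\<close>

lemma commutes_commI:
  assumes "commutes (comm x g) x" "commutes (comm x g) y"
    and "commutes (comm y g) x" "commutes (comm y g) y" "commutes (comm x g) (comm y g)"
  shows "commutes g (comm x y)"
proof -
  \<comment> \<open>Conjugation by \<open>g\<close> changes \<open>x\<close> and \<open>y\<close> only by elements commuting with both.\<close>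
  have conj: "- g + w + g = w + comm w g" for w
    by (simp add: comm_def group_simps)
  have "- g + comm x y + g = comm (x + comm x g) (y + comm y g)"
    by (simp add: comm_conj conj)
  also have "\<dots> = comm x y"
    using assms
    by (subst comm_add_left) (auto simp: comm_add_right intro!: commutes_add intro: commutes_sym)
  finally have "g + (- g + comm x y + g) = g + comm x y"
    by simp
  then show ?thesis
    by (simp add: commutes_def add.assoc)
qed

section \<open>Integer multiples and their commutators\<close>

lemma zmul_0 [simp]: "zmul 0 x = 0"
  by (simp add: zmul_def)

lemma zmul_succ: "zmul (n + 1) x = x + zmul n x"
proof (cases "0 \<le> n")
  case True
  then show ?thesis by (simp add: zmul_def nat_add_distrib)
next
  case False
  define k where "k = nat (- n - 1)"
  have k: "n = - int k - 1" "nat (- n) = Suc k" using False by (simp_all add: k_def)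
  have *: "(((+) x) ^^ k) 0 + x = x + (((+) x) ^^ k) 0" for k
    by (induction k) (simp_all add: add.assoc)
  \<comment> \<open>For \<open>k = 0\<close> the exponent \<open>n + 1\<close> is 0 and falls under
    the other branch of \<open>zmul\<close>.\<close>
  have "zmul (n + 1) x = - (((+) x) ^^ k) 0"
    by (cases k) (simp_all add: zmul_def k(1) nat_add_distrib)
  moreover have "zmul n x = - ((((+) x) ^^ k) 0 + x)"
    using False k(2) * [of k] by (simp add: zmul_def)
  ultimately show ?thesis
    by (simp add: group_simps)
qed

lemma zmul_1 [simp]: "zmul 1 x = x"
  using zmul_succ[of 0 x] by simp

lemma zmul_pred: "zmul (n - 1) x = - x + zmul n x"
  using zmul_succ[of "n - 1" x] by simp

lemma zmul_add: "zmul (m + n) x = zmul m x + zmul n x"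
proof (induction m rule: int_induct[where k = 0])
  case (step1 i)
  then show ?case
    using zmul_succ[of "i + n" x] by (simp add: zmul_succ[of i] add.assoc add.commute[of n 1])
next
  case (step2 i)
  then show ?case
    using zmul_pred[of "i + n" x] by (simp add: zmul_pred[of i] add.assoc add_diff_eq diff_add_eq)
qed simp

lemma zmul_minus: "zmul (- n) x = - zmul n x"
  using zmul_add[of "- n" n x] by (simp add: eq_neg_iff_add_eq_0)

lemma zmul_minus1: "zmul (- 1) x = - x"
  by (simp add: zmul_minus)

lemma zmul_mult: "zmul (m * n) x = zmul m (zmul n x)"
proof (induction m rule: int_induct[where k = 0])
  case (step1 i)
  then show ?case
    using zmul_add[of n "i * n" x] unfolding zmul_succ by (simp add: distrib_right add.commute)
next
  case (step2 i)
  then show ?case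
    using zmul_add[of "- n" "i * n" x] by (simp add: zmul_pred zmul_minus left_diff_distrib)
qed simp

lemma commutes_zmul_right: "commutes x y \<Longrightarrow> commutes x (zmul n y)"
  by (induction n rule: int_induct[where k = 0])
     (simp_all add: commutes_0 zmul_succ zmul_pred commutes_add commutes_minus)

lemma commutes_zmul: "commutes x y \<Longrightarrow> commutes (zmul m x) (zmul n y)"
  by (rule commutes_zmul_right[OF commutes_sym[OF commutes_zmul_right[OF commutes_sym]]])

lemma zmul_distrib:
  assumes "commutes x y"
  shows "zmul n (x + y) = zmul n x + zmul n y"
proof (induction n rule: int_induct[where k = 0])
  case (step1 i)
  then show ?case
    using commutes_left[of y "zmul i x"] commutes_zmul_right[of y x i] commutes_sym[OF assms]
    unfolding zmul_succ by (simp add: add.assoc)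
next
  case (step2 i)
  have "- (x + y) = - x + - y"
    using assms by (simp add: commutes_def minus_add)
  moreover have "commutes (- y) (zmul i x)"
    by (intro commutes_zmul_right commutes_sym[OF commutes_minus] assms)
  ultimately show ?case
    using step2 commutes_left[of "- y" "zmul i x"] unfolding zmul_pred by (simp add: add.assoc)
qed simp

lemma zmul_conj: "zmul n (- g + x + g) = - g + zmul n x + g"
  by (induction n rule: int_induct[where k = 0])
     (simp_all add: zmul_succ zmul_pred minus_add add.assoc)

text \<open>Conjugation by \<open>y\<close> sends \<open>x\<close> to \<open>x + comm x y\<close>;
  the two summands commute, so a multiple of the sum splits.\<close>

lemma comm_zmul_left:
  assumes "commutes (comm x y) x"
  shows "comm (zmul m x) y = zmul m (comm x y)"
proof -
  have "- y + zmul m x + y = zmul m (x + comm x y)"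
  proof -
    have "x + comm x y = - y + x + y"
      by (simp add: comm_def group_simps)
    then show ?thesis
      by (simp only: zmul_conj)
  qed
  also have "\<dots> = zmul m x + zmul m (comm x y)"
    by (rule zmul_distrib[OF commutes_sym[OF assms]])
  finally show ?thesis
    using commI[of "zmul m x" y "zmul m (comm x y)"] by (metis add.assoc add_minus_cancel)
qed

text \<open>The second argument is reached by reversing the commutator, which negates it. This
  bilinearity lets whole powers be exchanged in one collection step.\<close>

lemma comm_zmul:
  assumes "commutes (comm x y) x" "commutes (comm x y) y"
  shows "comm (zmul m x) (zmul n y) = zmul (m * n) (comm x y)"
proof -
  have "commutes (comm y x) y"
    using assms(2) minus_comm[of x y] by (metis commutes_minus commutes_sym)
  then have "comm x (zmul n y) = - zmul n (- comm x y)"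
    using comm_zmul_left[of y x n] minus_comm[of "zmul n y" x] by (simp add: minus_comm)
  also have "\<dots> = zmul (- n) (zmul (- 1) (comm x y))"
    by (simp only: zmul_minus zmul_1)
  also have "\<dots> = zmul n (comm x y)"
    by (simp only: zmul_mult[symmetric]) simp
  finally have *: "comm x (zmul n y) = zmul n (comm x y)" .
  then have "commutes (comm x (zmul n y)) x"
    using assms(1) by (metis commutes_sym commutes_zmul_right)
  from comm_zmul_left[OF this, of m] show ?thesis
    by (simp add: * zmul_mult)
qed

lemma zmul_even: "x + x = 0 \<Longrightarrow> even n \<Longrightarrow> zmul n x = 0"
proof (elim evenE)
  fix k assume "x + x = 0" "n = 2 * k"
  then have "zmul n x = zmul k (zmul (1 + 1) x)"
    by (simp add: mult.commute flip: zmul_mult)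
  also have "\<dots> = zmul k 0"
    unfolding zmul_add using \<open>x + x = 0\<close> by simp
  also have "\<dots> = 0"
    using zmul_mult[of k 0 0] by simp
  finally show "zmul n x = 0" .
qed

lemma zmul_cong_even: "x + x = 0 \<Longrightarrow> even (m - n) \<Longrightarrow> zmul m x = zmul n x"
  using zmul_add[of "m - n" n x] by (simp add: zmul_even)

section \<open>Collecting words in the generators\<close>

fun next_ix :: "ix \<Rightarrow> ix" where
  "next_ix X1 = X2" | "next_ix X2 = X3" | "next_ix X3 = X1"

fun third :: "ix \<Rightarrow> ix \<Rightarrow> ix" where
  "third X1 X2 = X3" | "third X2 X1 = X3" | "third X1 X3 = X2" | "third X3 X1 = X2"
| "third X2 X3 = X1" | "third X3 X2 = X1" | "third i _ = i" \<comment> \<open>junk value on the diagonal\<close>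

text \<open>The defining relations for two families in any group, so that they apply to the
  generators of the presented group and also to the images of these under sigma and rho. Together
  with \<open>P_sym\<close>, rotation gives all equalities among the z_ijk and among the
  t_ijk.\<close>

locale G3_system =
  fixes a b :: "ix \<Rightarrow> 'a::group_add"
  assumes ab: "commutes (a i) (b i)"
    and aa_a: "commutes (a i + a i) (a j)" and aa_b: "commutes (a i + a i) (b j)"
    and bb_a: "commutes (b i + b i) (a j)" and bb_b: "commutes (b i + b i) (b j)"
    and U_sym: "i \<noteq> j \<Longrightarrow> comm (a i) (a j) = comm (a j) (a i)"
    and V_sym: "i \<noteq> j \<Longrightarrow> comm (b i) (b j) = comm (b j) (b i)"
    and U_double: "i \<noteq> j \<Longrightarrow> comm (a i) (a j) + comm (a i) (a j) = 0"
    and V_double: "i \<noteq> j \<Longrightarrow> comm (b i) (b j) + comm (b i) (b j) = 0"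
    and U_a: "commutes (comm (a i) (a j)) (a k)" and U_b: "commutes (comm (a i) (a j)) (b k)"
    and V_a: "commutes (comm (b i) (b j)) (a k)" and V_b: "commutes (comm (b i) (b j)) (b k)"
    and P_sym: "i \<noteq> j \<Longrightarrow> comm (a i) (b j) = comm (a j) (b i)"
    and P_double: "i \<noteq> j \<Longrightarrow> comm (a i) (b j) + comm (a i) (b j) = 0"
    and Z_rot: "distinct3 i j k \<Longrightarrow> comm (comm (a i) (b j)) (a k) = comm (comm (a k) (b i)) (a j)"
    and T_rot: "distinct3 i j k \<Longrightarrow> comm (comm (a i) (b j)) (b k) = comm (comm (a k) (b i)) (b j)"
    and Z_double: "distinct3 i j k \<Longrightarrow>
      comm (comm (a i) (b j)) (a k) + comm (comm (a i) (b j)) (a k) = 0"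
    and T_double: "distinct3 i j k \<Longrightarrow>
      comm (comm (a i) (b j)) (b k) + comm (comm (a i) (b j)) (b k) = 0"
    and Z_a: "distinct3 i j k \<Longrightarrow> commutes (comm (comm (a i) (b j)) (a k)) (a l)"
    and Z_b: "distinct3 i j k \<Longrightarrow> commutes (comm (comm (a i) (b j)) (a k)) (b l)"
    and T_a: "distinct3 i j k \<Longrightarrow> commutes (comm (comm (a i) (b j)) (b k)) (a l)"
    and T_b: "distinct3 i j k \<Longrightarrow> commutes (comm (comm (a i) (b j)) (b k)) (b l)"

text \<open>With \<open>{i, j, k} = {1, 2, 3}\<close>, the letters \<open>LP k\<close>, \<open>LU k\<close>, \<open>LV k\<close> stand for
  \<open>p\<^sub>i\<^sub>j\<close>, \<open>u\<^sub>i\<^sub>j\<close>, \<open>v\<^sub>i\<^sub>j\<close>: the commutators of weight two are named by their missing index.\<close>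

datatype letter = LA ix | LB ix | LP ix | LU ix | LV ix | LZ | LT

fun letter_rank :: "letter \<Rightarrow> nat" where
  "letter_rank (LA i) = ixn i" | "letter_rank (LB i) = 3 + ixn i" | "letter_rank (LP i) = 6 + ixn i"
| "letter_rank (LU i) = 9 + ixn i" | "letter_rank (LV i) = 12 + ixn i"
| "letter_rank LZ = 16" | "letter_rank LT = 17"

text \<open>The commutator of a letter with one of smaller rank; \<open>None\<close> if the two commute. For pairs in
  the opposite order the value is meaningless.\<close>

fun swap_letter :: "letter \<Rightarrow> letter \<Rightarrow> letter option" where
  "swap_letter (LA i) (LA j) = (if i = j then None else Some (LU (third i j)))"
| "swap_letter (LB i) (LB j) = (if i = j then None else Some (LV (third i j)))"
| "swap_letter (LB i) (LA j) = (if i = j then None else Some (LP (third i j)))"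
| "swap_letter (LP i) (LA j) = (if i = j then Some LZ else None)"
| "swap_letter (LP i) (LB j) = (if i = j then Some LT else None)"
| "swap_letter _ _ = None"

section \<open>Letters and the commutators between them\<close>

context G3_system
begin

text \<open>The two other indices are taken in cyclic order; \<open>P_sym\<close>,
  \<open>U_sym\<close> and \<open>V_sym\<close> make the choice immaterial.\<close>

fun val :: "letter \<Rightarrow> 'a" where
  "val (LA i) = a i"
| "val (LB i) = b i"
| "val (LP i) = comm (a (next_ix i)) (b (next_ix (next_ix i)))"
| "val (LU i) = comm (a (next_ix i)) (a (next_ix (next_ix i)))"
| "val (LV i) = comm (b (next_ix i)) (b (next_ix (next_ix i)))"
| "val LZ = comm (comm (a X2) (b X3)) (a X1)"
| "val LT = comm (comm (a X2) (b X3)) (b X1)"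

lemma comm_a_a: "i \<noteq> j \<Longrightarrow> comm (a i) (a j) = val (LU (third i j))"
  using U_sym by (cases i; cases j) auto

lemma comm_b_b: "i \<noteq> j \<Longrightarrow> comm (b i) (b j) = val (LV (third i j))"
  using V_sym by (cases i; cases j) auto

lemma comm_a_b: "i \<noteq> j \<Longrightarrow> comm (a i) (b j) = val (LP (third i j))"
  using P_sym by (cases i; cases j) auto

text \<open>Reversal inverts a commutator, but [a_j, b_i] is its own inverse; \<open>P_sym\<close>
  then exchanges the indices.\<close>

lemma comm_b_a: "i \<noteq> j \<Longrightarrow> comm (b i) (a j) = comm (a i) (b j)"
  using P_sym[of i j] P_double[of j i] minus_comm[of "a j" "b i"] by (metis minus_unique)

lemma comm_P_a: "comm (val (LP i)) (a i) = val LZ"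
  using Z_rot[of X2 X3 X1] Z_rot[of X1 X2 X3] by (cases i) (auto simp: distinct3_def)

lemma comm_P_b: "comm (val (LP i)) (b i) = val LT"
  using T_rot[of X2 X3 X1] T_rot[of X1 X2 X3] by (cases i) (auto simp: distinct3_def)

lemma double: "(\<forall>i. l \<noteq> LA i \<and> l \<noteq> LB i) \<Longrightarrow> val l + val l = 0"
proof (cases l)
  case (LP i)
  then show ?thesis using P_double by (cases i) auto
next
  case (LU i)
  then show ?thesis using U_double by (cases i) auto
next
  case (LV i)
  then show ?thesis using V_double by (cases i) auto
qed (auto simp: Z_double T_double distinct3_def)

text \<open>Centrality relative to the letters only, as the ambient group may be larger than the
  subgroup they generate.\<close>

definition central_val :: "'a \<Rightarrow> bool" where
  "central_val x \<longleftrightarrow> (\<forall>l. commutes x (val l))"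

lemma central_valI:
  assumes "\<And>i. commutes x (a i)" "\<And>i. commutes x (b i)"
  shows "central_val x"
proof -
  have "commutes x (val l)" for l
    by (cases l) (simp_all add: assms commutes_comm)
  then show ?thesis by (simp add: central_val_def)
qed

lemma central_valD:
  assumes "central_val x"
  shows "commutes x (val l)" "commutes (val l) x" "commutes x (a i)" "commutes x (b i)"
  using assms unfolding central_val_def
  by (auto intro: commutes_sym, metis val.simps(1), metis val.simps(2))

lemma central_val_minus: "central_val x \<Longrightarrow> central_val (- x)"
  by (auto simp: central_val_def intro: commutes_sym commutes_minus)

lemma central_val_U: "central_val (val (LU i))"
  by (rule central_valI) (simp_all add: U_a U_b)

lemma central_val_V: "central_val (val (LV i))"
  by (rule central_valI) (simp_all add: V_a V_b)

lemma central_val_Z: "central_val (val LZ)"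
  by (rule central_valI) (simp_all add: Z_a Z_b distinct3_def)

lemma central_val_T: "central_val (val LT)"
  by (rule central_valI) (simp_all add: T_a T_b distinct3_def)

text \<open>Conjugation by a_j fixes b_j and changes a_i only by the central u_ij, hence fixes
  p_ij.\<close>

lemma commutes_a_P: "i \<noteq> j \<Longrightarrow> commutes (a j) (comm (a i) (b j))"
proof (rule commutes_commI)
  have "comm (b j) (a j) = 0"
    by (simp add: comm_eq_0_iff commutes_sym ab)
  then show "commutes (comm (b j) (a j)) (a i)" "commutes (comm (b j) (a j)) (b j)"
    "commutes (comm (a i) (a j)) (comm (b j) (a j))"
    by (simp_all add: commutes_0)
qed (simp_all add: U_a U_b)

lemma commutes_b_P: "i \<noteq> j \<Longrightarrow> commutes (b i) (comm (a i) (b j))"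
proof (rule commutes_commI)
  have "comm (a i) (b i) = 0"
    by (simp add: comm_eq_0_iff ab)
  then show "commutes (comm (a i) (b i)) (a i)" "commutes (comm (a i) (b i)) (b j)"
    "commutes (comm (a i) (b i)) (comm (b j) (b i))"
    by (simp_all add: commutes_0)
qed (simp_all add: V_a V_b)

lemma commutes_P_a: "i \<noteq> j \<Longrightarrow> commutes (val (LP i)) (a j)"
  using commutes_a_P P_sym by (cases i; cases j; simp; metis commutes_sym ix.distinct)

lemma commutes_P_b: "i \<noteq> j \<Longrightarrow> commutes (val (LP i)) (b j)"
  using commutes_b_P P_sym by (cases i; cases j; simp; metis commutes_sym ix.distinct)

text \<open>Any other p contains the index \<open>i\<close> and can be written [a_i, b_k].
  Conjugation by \<open>val (LP i)\<close> fixes b_k and changes a_i only by a central element, z or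
  its inverse.\<close>

lemma commutes_P_P: "commutes (val (LP i)) (val (LP j))"
proof -
  have *: "commutes (val (LP i)) (comm (a i) (b k))" if "i \<noteq> k" for i k
  proof (rule commutes_commI)
    have Z: "comm (a i) (val (LP i)) = - val LZ"
      by (simp only: minus_comm flip: comm_P_a[of i])
    have 0: "comm (b k) (val (LP i)) = 0"
      using commutes_P_b[OF that] by (simp add: comm_eq_0_iff commutes_sym)
    show "commutes (comm (a i) (val (LP i))) (a i)" "commutes (comm (a i) (val (LP i))) (b k)"
      unfolding Z by (simp_all only: central_valD[OF central_val_minus[OF central_val_Z]])
    show "commutes (comm (b k) (val (LP i))) (a i)" "commutes (comm (b k) (val (LP i))) (b k)"
      "commutes (comm (a i) (val (LP i))) (comm (b k) (val (LP i)))"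
      unfolding 0 by (simp_all add: commutes_0)
  qed
  have "i = j \<or> (\<exists>k. i \<noteq> k \<and> third i k = j)"
    by (cases i; cases j) (metis ix.distinct third.simps)+
  then show ?thesis
    using * by (auto simp: commutes_refl comm_a_b simp del: val.simps)
qed

text \<open>Provides the hypotheses of \<open>comm_zmul\<close>. Every created letter is central
  except \<open>LP\<close>, which arises only from generators carrying its own two indices.\<close>

lemma swap_letter_commutes:
  assumes "swap_letter l l' = Some c"
  shows "commutes (val c) (val l)" "commutes (val c) (val l')"
proof -
  have "third i j \<noteq> i" "third i j \<noteq> j" if "i \<noteq> j" for i j
    using that by (cases i; cases j; simp)+
  with assms have "commutes (val c) (val l) \<and> commutes (val c) (val l')"
    using central_val_U central_val_V central_val_Z central_val_T
    by (cases "(l, l')" rule: swap_letter.cases)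
       (auto simp: central_valD commutes_P_a commutes_P_b simp del: val.simps(3-)
        split: if_splits)
  then show "commutes (val c) (val l)" "commutes (val c) (val l')" by auto
qed

lemma swap_letter_comm:
  assumes "letter_rank l' < letter_rank l"
  shows "comm (val l) (val l') = (case swap_letter l l' of None \<Rightarrow> 0 | Some c \<Rightarrow> val c)"
proof -
  have ixn: "0 < ixn i" "ixn i \<le> 3" for i
    by (cases i; simp)+
  note c = central_val_U central_val_V central_val_Z central_val_T
  have comm_0: "comm x (val l') = 0" if "central_val x" for x
    using that by (simp add: comm_eq_0_iff central_val_def)
  have ba: "commutes (b i) (a i)" for i
    using ab by (rule commutes_sym)
  show ?thesis
  proof (cases l)
    case (LA i)
    then obtain j where "l' = LA j" "i \<noteq> j"
      using assms ixn(2)[of i] by (cases l') auto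
    with LA show ?thesis by (simp add: comm_a_a del: val.simps(3-))
  next
    case (LB i)
    then consider j where "l' = LA j" | j where "l' = LB j" "i \<noteq> j"
      using assms ixn(2)[of i] by (cases l') auto
    from this LB show ?thesis
      by cases (auto simp: comm_b_b comm_b_a comm_a_b comm_eq_0_iff ba simp del: val.simps(3-))
  next
    case (LP i)
    then consider j where "l' = LA j" | j where "l' = LB j" | j where "l' = LP j"
      using assms ixn(2)[of i] by (cases l') auto
    from this LP show ?thesis
      by cases (auto simp: comm_P_a comm_P_b comm_eq_0_iff commutes_P_a commutes_P_b commutes_P_P
          simp del: val.simps(3-))
  qed (simp_all add: comm_0 c del: val.simps)
qed

section \<open>Powers of letters, normal forms and exponent polynomials\<close>

definition E :: "letter \<Rightarrow> int \<Rightarrow> 'a" where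
  "E l n = zmul n (val l)"

lemma E_swap:
  assumes "letter_rank l' < letter_rank l"
  shows "E l m + E l' n =
    E l' n + (E l m + (case swap_letter l l' of None \<Rightarrow> 0 | Some c \<Rightarrow> E c (m * n)))"
proof (cases "swap_letter l l'")
  case None
  then show ?thesis
    using swap_letter_comm[OF assms] commutes_zmul[of "val l" "val l'" m n]
    by (simp add: E_def comm_eq_0_iff commutes_def)
next
  case (Some c)
  then have "comm (val l) (val l') = val c"
    using swap_letter_comm[OF assms] by simp
  then show ?thesis
    using Some swap_letter_commutes[OF Some] comm_zmul[of "val l" "val l'" m n]
      add_eq_add_comm[of "E l m" "E l' n"]
    by (simp add: E_def add.assoc)
qed

text \<open>The same exchange inside a right-nested sum, where a remainder follows the second
  power.\<close>

lemma E_swap_left: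
  assumes "letter_rank l' < letter_rank l"
  shows "E l m + (E l' n + x) =
    E l' n + (E l m + ((case swap_letter l l' of None \<Rightarrow> 0 | Some c \<Rightarrow> E c (m * n)) + x))"
proof -
  have "E l m + (E l' n + x) = (E l m + E l' n) + x"
    by (simp only: add.assoc)
  then show ?thesis
    unfolding E_swap[OF assms] by (simp only: add.assoc)
qed

lemma E_add: "E l m + E l n = E l (m + n)"
  by (simp add: E_def zmul_add)

lemma E_add_left: "E l m + (E l n + x) = E l (m + n) + x"
  by (simp add: E_def zmul_add add.assoc)

lemma E_0 [simp]: "E l 0 = 0"
  by (simp add: E_def)

lemma minus_E: "- E l n = E l (- n)"
  by (simp add: E_def zmul_minus)

lemmas collect = E_swap E_swap_left E_add E_add_left minus_E minus_add add.assoc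

definition nf :: "(letter \<Rightarrow> int) \<Rightarrow> 'a" where
  "nf s = E (LA X1) (s (LA X1)) + E (LA X2) (s (LA X2)) + E (LA X3) (s (LA X3))
    + E (LB X1) (s (LB X1)) + E (LB X2) (s (LB X2)) + E (LB X3) (s (LB X3))
    + E (LP X1) (s (LP X1)) + E (LP X2) (s (LP X2)) + E (LP X3) (s (LP X3))
    + E (LU X1) (s (LU X1)) + E (LU X2) (s (LU X2)) + E (LU X3) (s (LU X3))
    + E (LV X1) (s (LV X1)) + E (LV X2) (s (LV X2)) + E (LV X3) (s (LV X3))
    + E LZ (s LZ) + E LT (s LT)"

end

text \<open>The smaller and the larger of the other two indices; among letters of one kind they mark
  the pair that can be out of order.\<close>

fun lo_ix :: "ix \<Rightarrow> ix" where "lo_ix X1 = X2" | "lo_ix X2 = X1" | "lo_ix X3 = X1"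
fun hi_ix :: "ix \<Rightarrow> ix" where "hi_ix X1 = X3" | "hi_ix X2 = X3" | "hi_ix X3 = X2"

text \<open>The exponents of a product, found by moving the letters of the second factor to the left. For
  instance \<open>b\<^sub>l a\<^sub>k\<close> creates \<open>p\<^sub>k\<^sub>l\<close>, which in turn creates \<open>t\<close> when it passes the remaining
  \<open>b\<^sub>m\<close>; hence the terms of degree three.\<close>

definition exp_mult :: "(letter \<Rightarrow> int) \<Rightarrow> (letter \<Rightarrow> int) \<Rightarrow> letter \<Rightarrow> int" where
  "exp_mult s t l = s l + t l + (case l of
      LA i \<Rightarrow> 0 | LB i \<Rightarrow> 0
    | LU i \<Rightarrow> s (LA (hi_ix i)) * t (LA (lo_ix i))
    | LV i \<Rightarrow> s (LB (hi_ix i)) * t (LB (lo_ix i))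
    | LP i \<Rightarrow> s (LB (hi_ix i)) * t (LA (lo_ix i)) + s (LB (lo_ix i)) * t (LA (hi_ix i))
    | LZ \<Rightarrow> s (LP X1) * t (LA X1) + s (LP X2) * t (LA X2) + s (LP X3) * t (LA X3)
        + s (LB X3) * t (LA X1) * t (LA X2) + s (LB X2) * t (LA X1) * t (LA X3)
        + s (LB X1) * t (LA X2) * t (LA X3)
    | LT \<Rightarrow> s (LB X2) * s (LB X3) * t (LA X1) + s (LB X1) * s (LB X3) * t (LA X2)
        + s (LB X1) * s (LB X2) * t (LA X3)
        + (s (LP X1) + s (LB X3) * t (LA X2) + s (LB X2) * t (LA X3)) * t (LB X1)
        + (s (LP X2) + s (LB X3) * t (LA X1) + s (LB X1) * t (LA X3)) * t (LB X2)
        + (s (LP X3) + s (LB X2) * t (LA X1) + s (LB X1) * t (LA X2)) * t (LB X3))"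

text \<open>The images of a normal form under \<open>\<sigma>\<close> and \<open>\<rho>\<close>, each split into factors already in normal
  form.\<close>

definition exp_sigma :: "(letter \<Rightarrow> int) \<Rightarrow> letter \<Rightarrow> int" where
  "exp_sigma s = exp_mult (case_letter (\<lambda>_. 0) (\<lambda>i. s (LA i)) (\<lambda>_. 0) (\<lambda>_. 0) (\<lambda>_. 0) 0 0)
    (case_letter (\<lambda>i. s (LB i)) (\<lambda>_. 0) (\<lambda>i. s (LP i)) (\<lambda>i. s (LV i)) (\<lambda>i. s (LU i)) (s LT) (s LZ))"

text \<open>Each b_i becomes two letters, and b_1 is out of order before a_2, so every index gets
  its own factor. The last factor gathers the images of p, u, v, z and t, which commute with one
  another.\<close>

definition exp_rho :: "(letter \<Rightarrow> int) \<Rightarrow> letter \<Rightarrow> int" where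
  "exp_rho s = exp_mult (case_letter (\<lambda>_. 0) (\<lambda>i. s (LA i)) (\<lambda>_. 0) (\<lambda>_. 0) (\<lambda>_. 0) 0 0)
    (exp_mult (case_letter (\<lambda>i. of_bool (i = X1) * - s (LB i)) (\<lambda>i. of_bool (i = X1) * - s (LB i))
        (\<lambda>_. 0) (\<lambda>_. 0) (\<lambda>_. 0) 0 0)
    (exp_mult (case_letter (\<lambda>i. of_bool (i = X2) * - s (LB i)) (\<lambda>i. of_bool (i = X2) * - s (LB i))
        (\<lambda>_. 0) (\<lambda>_. 0) (\<lambda>_. 0) 0 0)
    (exp_mult (case_letter (\<lambda>i. of_bool (i = X3) * - s (LB i)) (\<lambda>i. of_bool (i = X3) * - s (LB i))
        (\<lambda>_. 0) (\<lambda>_. 0) (\<lambda>_. 0) 0 0)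
      (case_letter (\<lambda>_. 0) (\<lambda>_. 0) (\<lambda>i. s (LP i)) (\<lambda>i. s (LV i))
        (\<lambda>i. s (LP i) + s (LU i) + s (LV i)) (s LT) (s LZ + s LT)))))"

text \<open>Besides the summand \<open>t\<close>, the expression \<^term>\<open>exp_mult s t\<close> involves \<open>t\<close> only through its exponents
  at \<open>a\<^sub>i\<close> and \<open>b\<^sub>i\<close>, so the equation \<^term>\<open>exp_mult s x = t\<close> can be solved by inserting the first
  approximation \<open>t - s\<close>.\<close>

definition exp_ldiv :: "(letter \<Rightarrow> int) \<Rightarrow> (letter \<Rightarrow> int) \<Rightarrow> letter \<Rightarrow> int" where
  "exp_ldiv s t l = 2 * t l - s l - exp_mult s (\<lambda>m. t m - s m) l"

lemma exp_mult_ldiv: "exp_mult s (exp_ldiv s t) = t"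
proof
  fix l show "exp_mult s (exp_ldiv s t) l = t l"
    by (cases l) (simp_all add: exp_mult_def exp_ldiv_def add_uminus_conv_diff)
qed

fun nf_eq_at :: "(letter \<Rightarrow> int) \<Rightarrow> (letter \<Rightarrow> int) \<Rightarrow> letter \<Rightarrow> bool" where
  "nf_eq_at s t (LA i) \<longleftrightarrow> s (LA i) = t (LA i)"
| "nf_eq_at s t (LB i) \<longleftrightarrow> s (LB i) = t (LB i)"
| "nf_eq_at s t l \<longleftrightarrow> even (s l - t l)"

context G3_system
begin

text \<open>The first pass collects both sides, the second compares the exponents, which agree
  exactly as integer polynomials.\<close>

lemma nf_add: "nf s + nf t = nf (exp_mult s t)"
  unfolding nf_def exp_mult_def by (simp add: collect) (simp add: algebra_simps)

text \<open>Reduction modulo 2 rests on \<open>double\<close>. The converse fails for some families,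
  for instance trivial ones.\<close>

lemma nf_cong:
  assumes "\<And>l. nf_eq_at s t l"
  shows "nf s = nf t"
proof -
  have "E l (s l) = E l (t l)" for l
    using assms[of l] by (cases l) (auto simp: E_def double simp del: val.simps intro!: zmul_cong_even)
  then show ?thesis
    by (simp add: nf_def)
qed

text \<open>Not a rule to collect with: it must be applied to words that are already collected.\<close>

lemma E_odd: "(\<forall>i. l \<noteq> LA i \<and> l \<noteq> LB i) \<Longrightarrow> E l n = (if even n then 0 else val l)"
  using zmul_cong_even[OF double, of l n 1] by (auto simp: E_def zmul_even double simp del: val.simps)

section \<open>Commutators of the images under rho\<close>

lemma val_E: "val l = E l 1"
  by (simp add: E_def)

text \<open>The intended image of \<open>b i\<close> under rho.\<close>

definition b' :: "ix \<Rightarrow> 'a" where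
  "b' i = - a i + - b i"

lemma b'_E: "b' i = E (LA i) (- 1) + E (LB i) (- 1)"
  by (simp add: b'_def E_def zmul_minus)

lemma a_E: "a i = E (LA i) 1" and b_E: "b i = E (LB i) 1"
  by (simp_all add: E_def)

text \<open>Expanding also produces p_ij twice, once from each mixed pair, and the two
  cancel.\<close>

lemma comm_b'_b':
  assumes "i \<noteq> j"
  shows "comm (b' i) (b' j) = val (LU (third i j)) + val (LV (third i j))"
  unfolding comm_def b'_E val_E using assms
  by (cases i; cases j, simp_all)
     (simp_all add: collect del: val.simps, simp_all add: E_odd del: val.simps)

lemma comm_b_b':
  assumes "i \<noteq> j"
  shows "comm (b i) (b' j) = val (LV (third i j)) + val (LP (third i j))"
  unfolding comm_def b'_E b_E[of i] val_E using assms
  by (cases i; cases j, simp_all)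
     (simp_all add: collect del: val.simps, simp_all add: E_odd del: val.simps)

text \<open>As rho sends p to v + p, this and the next lemma compute the images of z and t; the
  central v does not affect the commutator.\<close>

lemma comm_VP_b: "comm (val (LV i) + val (LP i)) (b i) = val LT"
  unfolding comm_def b_E[of i] val_E
  by (cases i) (simp_all add: collect del: val.simps)

lemma comm_VP_b': "comm (val (LV i) + val (LP i)) (b' i) = val LZ + val LT"
  unfolding comm_def b'_E val_E
  by (cases i)
     (simp_all add: collect del: val.simps, simp_all add: E_odd del: val.simps)

end

section \<open>The endomorphisms and the triality identity on normal forms\<close>

definition add_hom :: "('a::group_add \<Rightarrow> 'b::group_add) \<Rightarrow> bool" where
  "add_hom h \<longleftrightarrow> (\<forall>x y. h (x + y) = h x + h y)"

lemma add_hom_0: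
  assumes "add_hom h"
  shows "h 0 = 0"
proof -
  have "h (0 + 0) = h 0 + h 0"
    using assms unfolding add_hom_def by blast
  then show ?thesis
    using add_left_cancel[of "h 0" "h 0" 0] by simp
qed

lemma add_hom_minus:
  assumes "add_hom h"
  shows "h (- x) = - h x"
proof -
  have "h (- x) + h x = h (- x + x)"
    using assms unfolding add_hom_def by metis
  then show ?thesis
    using add_hom_0[OF assms] by (simp add: eq_neg_iff_add_eq_0)
qed

lemma add_hom_comm: "add_hom h \<Longrightarrow> h (comm x y) = comm (h x) (h y)"
  by (simp add: comm_def add_hom_minus) (simp add: add_hom_def add_hom_minus)

lemma add_hom_zmul: "add_hom h \<Longrightarrow> h (zmul n x) = zmul n (h x)"
  by (induction n rule: int_induct[where k = 0])
     (simp_all add: add_hom_0 zmul_succ zmul_pred add_hom_def add_hom_minus)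

lemma double_add: "commutes x y \<Longrightarrow> x + x = 0 \<Longrightarrow> y + y = 0 \<Longrightarrow> (x + y) + (x + y) = 0"
  using commutes_left[of y x y] by (simp add: commutes_sym add.assoc flip: add.assoc[of x x])

section \<open>The relations for the images of the generators\<close>

context G3_system
begin

text \<open>The relations are symmetric in the two families: by \<open>comm_b_a\<close> the p_ij
  stay fixed, while u and v, and likewise z and t, change places.\<close>

lemma swap_system: "G3_system b a"
proof unfold_locales
  fix i j k :: ix
  assume d: "distinct3 i j k"
  then have ne: "i \<noteq> j" "j \<noteq> i" "k \<noteq> i" by (auto simp: distinct3_def)
  show "comm (comm (b i) (a j)) (b k) = comm (comm (b k) (a i)) (b j)"
    "comm (comm (b i) (a j)) (a k) = comm (comm (b k) (a i)) (a j)"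
    using d ne Z_rot[of i j k] T_rot[of i j k] by (simp_all add: comm_b_a)
  show "comm (comm (b i) (a j)) (b k) + comm (comm (b i) (a j)) (b k) = 0"
    "comm (comm (b i) (a j)) (a k) + comm (comm (b i) (a j)) (a k) = 0"
    using d ne by (simp_all add: comm_b_a Z_double T_double)
  show "commutes (comm (comm (b i) (a j)) (b k)) (b l)" "commutes (comm (comm (b i) (a j)) (b k)) (a l)"
    "commutes (comm (comm (b i) (a j)) (a k)) (b l)" "commutes (comm (comm (b i) (a j)) (a k)) (a l)" for l
    using d ne by (simp_all add: comm_b_a Z_a Z_b T_a T_b)
qed (use P_sym in \<open>simp_all add: commutes_sym ab aa_a aa_b bb_a bb_b U_sym V_sym U_double V_double
  U_a U_b V_a V_b comm_b_a P_double\<close>)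

lemma commutes_b': "commutes x (a i) \<Longrightarrow> commutes x (b i) \<Longrightarrow> commutes x (b' i)"
  unfolding b'_def by (intro commutes_add commutes_minus)

lemma central_val_b': "central_val x \<Longrightarrow> commutes x (b' i)"
  by (simp add: commutes_b' central_valD)

lemma double_b': "b' i + b' i = - (a i + a i) + - (b i + b i)"
  using commutes_left[of "- b i" "- a i"] commutes_minus[OF commutes_sym[OF commutes_minus[OF ab[of i]]]]
  by (simp add: b'_def minus_add add.assoc)

lemma central_val_double: "central_val (a i + a i)" "central_val (b i + b i)"
  by (auto intro!: central_valI simp: aa_a aa_b bb_a bb_b)

lemma central_val_add: "central_val x \<Longrightarrow> central_val y \<Longrightarrow> central_val (x + y)"
  unfolding central_val_def by (meson commutes_add commutes_sym)

lemma third_eq: "distinct3 i j k \<Longrightarrow> third i j = k"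
  by (cases i; cases j; cases k) (simp_all add: distinct3_def)

lemma third_sym: "third i j = third j i"
  by (cases i; cases j) simp_all

text \<open>For the new families u, v, p, z, t become v, u + v, v + p, t, z + t, so the relations
  follow from commutations and orders of the old letters.\<close>

lemma rho_system: "G3_system b b'"
proof unfold_locales
  fix i j k l :: ix
  note c = central_val_U central_val_V central_val_Z central_val_T central_val_add central_val_minus
    central_val_double
  show "commutes (b i) (b' i)"
    by (simp add: commutes_b' commutes_refl commutes_sym ab)
  show "commutes (b i + b i) (b j)" "commutes (b i + b i) (b' j)"
    by (simp_all add: bb_b commutes_b' bb_a)
  have "central_val (b' i + b' i)"
    unfolding double_b' by (simp only: c)
  then show "commutes (b' i + b' i) (b j)" "commutes (b' i + b' i) (b' j)"
    by (simp_all add: central_valD central_val_b')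
  show "commutes (comm (b i) (b j)) (b k)" "commutes (comm (b i) (b j)) (b' k)"
    by (simp_all add: V_a V_b commutes_b')
  have "central_val (comm (b' i) (b' j))"
  \<comment> \<open>Centrality is required for equal indices too, which \<open>comm_b'_b'\<close>
    does not cover.\<close>
  proof (cases "i = j")
    case True
    then have "comm (b' i) (b' j) = 0"
      by (simp add: comm_eq_0_iff commutes_refl)
    then show ?thesis by (simp add: central_val_def commutes_0)
  qed (simp add: comm_b'_b' c del: val.simps)
  then show "commutes (comm (b' i) (b' j)) (b k)" "commutes (comm (b' i) (b' j)) (b' k)"
    by (simp_all add: central_valD central_val_b')
  show "comm (b i) (b j) = comm (b j) (b i)" "comm (b i) (b j) + comm (b i) (b j) = 0"
    "comm (b' i) (b' j) = comm (b' j) (b' i)" "comm (b i) (b' j) = comm (b j) (b' i)"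
    if "i \<noteq> j"
    using that by (simp_all add: V_sym V_double comm_b'_b' comm_b_b' third_sym del: val.simps)
  show "comm (b' i) (b' j) + comm (b' i) (b' j) = 0" "comm (b i) (b' j) + comm (b i) (b' j) = 0"
    if "i \<noteq> j"
    using that
    by (simp_all add: comm_b'_b' comm_b_b' double_add central_valD c double del: val.simps)
next
  fix i j k l :: ix
  assume d: "distinct3 i j k"
  then have ne: "i \<noteq> j" "k \<noteq> i" and t: "third i j = k" "third k i = j"
    by (auto simp: distinct3_def third_eq)
  have Z: "comm (comm (b i) (b' j)) (b k) = val LT" "comm (comm (b k) (b' i)) (b j) = val LT"
    "comm (comm (b i) (b' j)) (b' k) = val LZ + val LT"
    "comm (comm (b k) (b' i)) (b' j) = val LZ + val LT"
    using comm_VP_b comm_VP_b' by (simp_all only: comm_b_b'[OF ne(1)] comm_b_b'[OF ne(2)] t)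
  have c: "central_val (val LT)" "central_val (val LZ + val LT)"
    by (simp_all only: central_val_Z central_val_T central_val_add)
  show "comm (comm (b i) (b' j)) (b k) = comm (comm (b k) (b' i)) (b j)"
    "comm (comm (b i) (b' j)) (b' k) = comm (comm (b k) (b' i)) (b' j)"
    by (simp_all only: Z)
  show "comm (comm (b i) (b' j)) (b k) + comm (comm (b i) (b' j)) (b k) = 0"
    "comm (comm (b i) (b' j)) (b' k) + comm (comm (b i) (b' j)) (b' k) = 0"
    unfolding Z by (simp_all add: double_add double central_valD central_val_Z del: val.simps)
  show "commutes (comm (comm (b i) (b' j)) (b k)) (b l)"
    "commutes (comm (comm (b i) (b' j)) (b k)) (b' l)"
    "commutes (comm (comm (b i) (b' j)) (b' k)) (b l)"
    "commutes (comm (comm (b i) (b' j)) (b' k)) (b' l)"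
    unfolding Z by (simp_all add: central_valD(4)[OF c(1)] central_valD(4)[OF c(2)]
        central_val_b'[OF c(1)] central_val_b'[OF c(2)] del: val.simps)
qed

section \<open>Images of normal forms\<close>

lemma add_hom_E: "add_hom h \<Longrightarrow> h (E l n) = zmul n (h (val l))"
  by (simp add: E_def add_hom_zmul)

lemma hom_exp_sigma:
  assumes h: "add_hom h" and "\<And>i. h (a i) = b i" "\<And>i. h (b i) = a i"
  shows "h (nf s) = nf (exp_sigma s)"
proof -
  have P: "h (val (LP i)) = val (LP i)" for i
    using comm_b_a[of "next_ix i" "next_ix (next_ix i)"] assms
    by (cases i) (simp_all add: add_hom_comm)
  have Z: "h (val LZ) = val LT" "h (val LT) = val LZ"
    using assms by (simp_all add: add_hom_comm comm_b_a)
  have E: "h (E (LA i) n) = E (LB i) n" "h (E (LB i) n) = E (LA i) n" "h (E (LP i) n) = E (LP i) n"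
    "h (E (LU i) n) = E (LV i) n" "h (E (LV i) n) = E (LU i) n" "h (E LZ n) = E LT n" "h (E LT n) = E LZ n"
    for i n
    unfolding add_hom_E[OF h] P Z using assms by (simp_all add: E_def add_hom_comm)
  show ?thesis
    unfolding exp_sigma_def nf_add[symmetric] unfolding nf_def
    using h by (simp add: add_hom_def E, simp add: collect, simp add: algebra_simps)
qed

lemma hom_exp_rho:
  assumes h: "add_hom h" and a: "\<And>i. h (a i) = b i" and b: "\<And>i. h (b i) = b' i"
  shows "h (nf s) = nf (exp_rho s)"
proof -
  have P: "h (val (LP i)) = val (LV i) + val (LP i)" for i
    using comm_b_b'[of "next_ix i" "next_ix (next_ix i)"] h
    by (cases i) (simp_all add: add_hom_comm a b)
  have V: "h (val (LV i)) = val (LU i) + val (LV i)" for i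
    using comm_b'_b'[of "next_ix i" "next_ix (next_ix i)"] h
    by (cases i) (simp_all add: add_hom_comm a b)
  have Z: "h (val LZ) = val LT"
    using P[of X1] comm_VP_b[of X1] h by (simp add: add_hom_comm a)
  have T: "h (val LT) = val LZ + val LT"
    using P[of X1] comm_VP_b'[of X1] h by (simp add: add_hom_comm a b)
  have zm: "zmul n (val l + val m) = E l n + E m n" if "commutes (val l) (val m)" for n l m
    using that by (simp add: E_def zmul_distrib)
  have ba: "zmul n (b' i) = E (LA i) (- n) + E (LB i) (- n)" for i n
  proof -
    have "commutes (- a i) (- b i)"
      by (rule commutes_minus[OF commutes_sym[OF commutes_minus[OF commutes_sym[OF ab]]]])
    moreover have "zmul n (- x) = zmul (- n) x" for x :: 'a
      using zmul_mult[of n "- 1" x] by (simp add: zmul_minus1)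
    ultimately show ?thesis
      by (simp add: b'_def zmul_distrib E_def)
  qed
  have E: "h (E (LA i) n) = E (LB i) n" "h (E (LB i) n) = E (LA i) (- n) + E (LB i) (- n)"
    "h (E (LP i) n) = E (LV i) n + E (LP i) n" "h (E (LU i) n) = E (LV i) n"
    "h (E (LV i) n) = E (LU i) n + E (LV i) n" "h (E LZ n) = E LT n" "h (E LT n) = E LZ n + E LT n"
    for i n
    unfolding add_hom_E[OF h] P V Z T zm[OF central_valD(1)[OF central_val_V]]
      zm[OF central_valD(1)[OF central_val_U]] zm[OF central_valD(1)[OF central_val_Z]]
    using h by (simp_all add: ba a b) (simp_all add: E_def add_hom_comm a b)
  \<comment> \<open>The letters beyond the generators commute pairwise, so the image of this tail is
    sorted without creating new letters.\<close>
  define w where "w = E (LP X1) (s (LP X1)) + E (LP X2) (s (LP X2)) + E (LP X3) (s (LP X3))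
    + E (LU X1) (s (LU X1)) + E (LU X2) (s (LU X2)) + E (LU X3) (s (LU X3))
    + E (LV X1) (s (LV X1)) + E (LV X2) (s (LV X2)) + E (LV X3) (s (LV X3))
    + E LZ (s LZ) + E LT (s LT)"
  have "nf s = E (LA X1) (s (LA X1)) + (E (LA X2) (s (LA X2)) + (E (LA X3) (s (LA X3))
    + (E (LB X1) (s (LB X1)) + (E (LB X2) (s (LB X2)) + (E (LB X3) (s (LB X3)) + w)))))"
    by (simp add: nf_def w_def add.assoc)
  moreover have "h w = nf (case_letter (\<lambda>_. 0) (\<lambda>_. 0) (\<lambda>i. s (LP i)) (\<lambda>i. s (LV i))
        (\<lambda>i. s (LP i) + s (LU i) + s (LV i)) (s LT) (s LZ + s LT))"
    unfolding w_def using h by (simp add: add_hom_def E, simp add: nf_def collect)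
  ultimately have "h (nf s) = E (LB X1) (s (LA X1)) + (E (LB X2) (s (LA X2)) + (E (LB X3) (s (LA X3))
    + (E (LA X1) (- s (LB X1)) + (E (LB X1) (- s (LB X1)) + (E (LA X2) (- s (LB X2))
    + (E (LB X2) (- s (LB X2)) + (E (LA X3) (- s (LB X3)) + (E (LB X3) (- s (LB X3))
    + nf (case_letter (\<lambda>_. 0) (\<lambda>_. 0) (\<lambda>i. s (LP i)) (\<lambda>i. s (LV i))
        (\<lambda>i. s (LP i) + s (LU i) + s (LV i)) (s LT) (s LZ + s LT))))))))))"
    using h by (simp add: add_hom_def E add.assoc)
  also have "\<dots> = nf (exp_rho s)"
    unfolding exp_rho_def nf_add[symmetric]
    by (simp add: nf_def[of "case_letter f (g :: ix \<Rightarrow> int) (\<lambda>_. 0) (\<lambda>_. 0) (\<lambda>_. 0) 0 0" for f g]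
        add.assoc)
  finally show ?thesis .
qed

end

declare add_uminus_conv_diff [simp]

section \<open>The triality identity\<close>

context G3_system
begin

text \<open>The commutator \<open>[g, \<sigma>]\<close> has opposite exponents at \<open>a\<^sub>i\<close> and \<open>b\<^sub>i\<close> and even exponents at
  the \<open>p\<^sub>i\<^sub>j\<close>; this alone forces the triality identity.\<close>

lemma triality_nf_eq:
  assumes "\<And>i. c (LB i) = - c (LA i)" "\<And>i. even (c (LP i))"
  shows "nf_eq_at (exp_mult (exp_mult c (exp_rho c)) (exp_rho (exp_rho c))) (\<lambda>_. 0) l"
    (is "?Q l")
proof -
  have "?Q (LA i)" "?Q (LB i)" "?Q (LP i)" "?Q (LU i)" "?Q (LV i)" for i
    using assms by (cases i; auto simp: exp_mult_def exp_rho_def)+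
  moreover have "?Q LZ" "?Q LT"
    using assms by (auto simp: exp_mult_def exp_rho_def)
  ultimately show ?thesis
    by (cases l) blast+
qed

lemma sigma_ldiv_B: "exp_ldiv s (exp_sigma s) (LB i) = - exp_ldiv s (exp_sigma s) (LA i)"
  by (simp add: exp_ldiv_def exp_sigma_def exp_mult_def)

text \<open>The exponents of p itself cancel because sigma fixes p, and every remaining product of
  exponents occurs twice.\<close>

lemma even_sigma_ldiv_P: "even (exp_ldiv s (exp_sigma s) (LP i))"
  by (cases i) (auto simp: exp_ldiv_def exp_sigma_def exp_mult_def)

lemma nf_0: "nf (\<lambda>_. 0) = 0"
  by (simp add: nf_def)

lemma triality_nf:
  fixes \<sigma> \<rho> :: "'a \<Rightarrow> 'a"
  assumes \<sigma>: "add_hom \<sigma>" "\<And>i. \<sigma> (a i) = b i" "\<And>i. \<sigma> (b i) = a i"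
    and \<rho>: "add_hom \<rho>" "\<And>i. \<rho> (a i) = b i" "\<And>i. \<rho> (b i) = b' i"
    and c: "c = - nf s + \<sigma> (nf s)"
  shows "c + \<rho> c + \<rho> (\<rho> c) = 0"
proof -
  define d where "d = exp_ldiv s (exp_sigma s)"
  have "nf s + nf d = nf (exp_sigma s)"
    by (simp add: d_def nf_add exp_mult_ldiv)
  then have "c = nf d"
    unfolding c hom_exp_sigma[OF \<sigma>] by (metis minus_add_cancel)
  then have "c + \<rho> c + \<rho> (\<rho> c) = nf (exp_mult (exp_mult d (exp_rho d)) (exp_rho (exp_rho d)))"
    by (simp add: hom_exp_rho[OF \<rho>] nf_add)
  also have "\<dots> = nf (\<lambda>_. 0)"
    unfolding d_def by (intro nf_cong triality_nf_eq sigma_ldiv_B even_sigma_ldiv_P)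
  finally show ?thesis
    by (simp add: nf_0)
qed

lemma E_nf: "E l n = nf (\<lambda>m. if m = l then n else 0)"
proof -
  \<comment> \<open>An index is provided even for \<open>LZ\<close> and \<open>LT\<close>, so that
    one case distinction on \<open>i\<close> serves all letters.\<close>
  have "\<exists>i. l = LA i \<or> l = LB i \<or> l = LP i \<or> l = LU i \<or> l = LV i \<or> l = LZ \<or> l = LT"
    by (cases l) auto
  then obtain i where "l = LA i \<or> l = LB i \<or> l = LP i \<or> l = LU i \<or> l = LV i \<or> l = LZ \<or> l = LT" ..
  then show ?thesis
    by (elim disjE; cases i) (simp_all add: nf_def)
qed

end

section \<open>The presented group as an additive group\<close>

lemma G3_eqv_append: "G3_eqv u u' \<Longrightarrow> G3_eqv (x @ u @ y) (x @ u' @ y)"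
proof (induction rule: G3_eqv.induct)
  case (cancel u z e v)
  then show ?case
    using G3_eqv.cancel[of "x @ u" z e "v @ y"] by simp
next
  case (rel l r u v)
  then show ?case
    using G3_eqv.rel[of l r "x @ u" "v @ y"] by simp
qed (auto intro: G3_eqv.intros)

lemma G3_eqv_append2: "G3_eqv u u' \<Longrightarrow> G3_eqv v v' \<Longrightarrow> G3_eqv (u @ v) (u' @ v')"
  using G3_eqv_append[of u u' "[]" v] G3_eqv_append[of v v' u' "[]"] by (auto intro: G3_eqv.trans)

lemma winv_Cons: "winv ((x, e) # w) = winv w @ [(x, \<not> e)]"
  by (simp add: winv_def)

lemma winv_winv: "winv (winv w) = w"
  by (simp add: winv_def rev_map comp_def case_prod_beta)

lemma G3_eqv_winv_left: "G3_eqv (winv w @ w) []"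
proof (induction w)
  case Nil
  then show ?case by (simp add: winv_def G3_eqv.refl)
next
  case (Cons l w)
  obtain x e where l: "l = (x, e)" by force
  have "G3_eqv (winv (l # w) @ l # w) (winv w @ w)"
    using G3_eqv.cancel[of "winv w" x "\<not> e" w] by (simp add: l winv_Cons)
  with Cons show ?case by (blast intro: G3_eqv.trans)
qed

text \<open>Uniqueness of inverses: \<open>winv u @ u @ winv v\<close> is equivalent to both
  sides.\<close>

lemma G3_eqv_winv:
  assumes "G3_eqv u v"
  shows "G3_eqv (winv u) (winv v)"
proof -
  have right: "G3_eqv (v @ winv v) []"
    using G3_eqv_winv_left[of "winv v"] by (simp add: winv_winv)
  have "G3_eqv (winv u @ v @ winv v) (winv u)"
    using G3_eqv_append[OF right, of "winv u" "[]"] by simp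
  moreover have "G3_eqv (winv u @ u @ winv v) (winv u @ v @ winv v)"
    by (rule G3_eqv_append[OF assms])
  moreover have "G3_eqv (winv u @ u @ winv v) (winv v)"
    using G3_eqv_append[OF G3_eqv_winv_left, of "[]" u "winv v"] by simp
  ultimately show ?thesis by (blast intro: G3_eqv.sym G3_eqv.trans)
qed

lemma equivp_G3_eqv: "equivp G3_eqv"
  by (intro equivpI reflpI sympI transpI) (blast intro: G3_eqv.intros)+

\<comment> \<open>The group \<open>G3\<close> again, now as a type, which can be made an instance of
  \<open>group_add\<close>.\<close>
quotient_type g3 = word / G3_eqv
  by (rule equivp_G3_eqv)

instantiation g3 :: group_add
begin

lift_definition zero_g3 :: g3 is "[]" .
lift_definition plus_g3 :: "g3 \<Rightarrow> g3 \<Rightarrow> g3" is "(@)" by (rule G3_eqv_append2)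
lift_definition uminus_g3 :: "g3 \<Rightarrow> g3" is winv by (rule G3_eqv_winv)
definition minus_g3 :: "g3 \<Rightarrow> g3 \<Rightarrow> g3" where "minus_g3 x y = x + - y"

instance
proof
  fix x y z :: g3
  show "x + y + z = x + (y + z)" by transfer (simp add: G3_eqv.refl)
  show "0 + x = x" "x + 0 = x" by (transfer, simp add: G3_eqv.refl)+
  show "- x + x = 0" by transfer (rule G3_eqv_winv_left)
  show "x + - y = x - y" by (simp add: minus_g3_def)
qed

end

lemma g3_cases:
  obtains w where "x = abs_g3 w"
  using that by (induction x rule: g3.abs_induct) blast

section \<open>Evaluation of words and the universal property\<close>

definition word_val :: "(gen \<Rightarrow> 'a::group_add) \<Rightarrow> word \<Rightarrow> 'a" where
  "word_val f w = sum_list (map (\<lambda>(x, e). if e then - f x else f x) w)"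

lemma word_val_simps [simp]:
  "word_val f [] = 0"
  "word_val f ((x, e) # w) = (if e then - f x else f x) + word_val f w"
  "word_val f (u @ v) = word_val f u + word_val f v"
  by (simp_all add: word_val_def)

lemma word_val_winv [simp]: "word_val f (winv w) = - word_val f w"
  by (induction w) (auto simp: winv_Cons minus_add, simp add: winv_def)

lemma word_val_wcomm [simp]: "word_val f (wcomm u v) = comm (word_val f u) (word_val f v)"
  by (simp add: wcomm_def comm_def add.assoc del: add_uminus_conv_diff)

lemma (in G3_system) word_val_rels:
  assumes "(l, r) \<in> G3_rels"
  shows "word_val (case_gen a b) l = word_val (case_gen a b) r"
proof -
  have ne: "ixn i < ixn j \<Longrightarrow> i \<noteq> j" for i j by auto
  \<comment> \<open>The relations z_ijk = z_jik and t_ijk = t_jik come from p_ij = p_ji.\<close>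
  have d: "distinct3 i j k \<Longrightarrow> comm (comm (a i) (b j)) x = comm (comm (a j) (b i)) x" for i j k x
    using P_sym[of i j] by (simp add: distinct3_def)
  note [simp] = wa_def wb_def wu_def wv_def wp_def wz_def wt_def
  show ?thesis
    using assms unfolding G3_rels_def central_rels_def wgens_def
    by (auto simp: comm_eq_0_iff ab aa_a aa_b bb_a bb_b U_a U_b V_a V_b Z_a Z_b T_a T_b
      U_double V_double P_double Z_double T_double intro: d U_sym V_sym P_sym Z_rot T_rot
      dest!: ne split: if_splits)
qed

lemma (in G3_system) word_val_cong:
  "G3_eqv u v \<Longrightarrow> word_val (case_gen a b) u = word_val (case_gen a b) v"
proof (induction rule: G3_eqv.induct)
  case (cancel u x e v)
  then show ?case by (simp flip: add.assoc)
qed (auto simp: word_val_rels)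

definition g3_a :: "ix \<Rightarrow> g3" where "g3_a i = abs_g3 (wa i)"
definition g3_b :: "ix \<Rightarrow> g3" where "g3_b i = abs_g3 (wb i)"

lemma abs_g3_word_val: "abs_g3 w = word_val (case_gen g3_a g3_b) w"
proof (induction w)
  case Nil
  then show ?case by (simp add: zero_g3_def)
next
  case (Cons l w)
  obtain x e where l: "l = (x, e)" by force
  have "abs_g3 [(x, e)] = (if e then - case_gen g3_a g3_b x else case_gen g3_a g3_b x)"
    by (cases x) (auto simp: g3_a_def g3_b_def wa_def wb_def uminus_g3.abs_eq winv_def)
  then show ?case
    using Cons plus_g3.abs_eq[of "[l]" w] by (simp add: l)
qed

lemma abs_g3_rel: "(l, r) \<in> G3_rels \<Longrightarrow> abs_g3 l = abs_g3 r"
  using G3_eqv.rel[of l r "[]" "[]"] by (simp add: g3.abs_eq_iff)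

lemma word_val_g3_rel:
  "(l, r) \<in> G3_rels \<Longrightarrow> word_val (case_gen g3_a g3_b) l = word_val (case_gen g3_a g3_b) r"
  using abs_g3_rel by (simp add: abs_g3_word_val)

lemma central_rels_commutes:
  assumes "central_rels w \<subseteq> G3_rels"
  shows "commutes (word_val (case_gen g3_a g3_b) w) (g3_a i)"
    "commutes (word_val (case_gen g3_a g3_b) w) (g3_b i)"
proof -
  have "(wcomm w (wa i), []) \<in> G3_rels" "(wcomm w (wb i), []) \<in> G3_rels"
    using assms by (auto simp: central_rels_def wgens_def)
  from this[THEN word_val_g3_rel]
  show "commutes (word_val (case_gen g3_a g3_b) w) (g3_a i)"
    "commutes (word_val (case_gen g3_a g3_b) w) (g3_b i)"
    by (simp_all add: comm_eq_0_iff wa_def wb_def)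
qed

lemma G3_system_g3: "G3_system g3_a g3_b"
proof -
  note w = wa_def wb_def wu_def wv_def wp_def wz_def wt_def
  have c: "central_rels (wa i @ wa i) \<subseteq> G3_rels" "central_rels (wb i @ wb i) \<subseteq> G3_rels"
    "central_rels (wu i j) \<subseteq> G3_rels" "central_rels (wv i j) \<subseteq> G3_rels" for i j
    by (auto simp: G3_rels_def)
  have cz: "central_rels (wz i j k) \<subseteq> G3_rels" "central_rels (wt i j k) \<subseteq> G3_rels"
    if "distinct3 i j k" for i j k
    using that unfolding G3_rels_def by (intro subsetI UnI2 UN_I[of i] UN_I[of j] UN_I[of k]; simp)+
  note c' = central_rels_commutes[OF c(1)] central_rels_commutes[OF c(2)]
    central_rels_commutes[OF c(3)] central_rels_commutes[OF c(4)]
    central_rels_commutes[OF cz(1)] central_rels_commutes[OF cz(2)]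
  have ab: "(wcomm (wa i) (wb i), []) \<in> G3_rels" for i
    by (auto simp: G3_rels_def)
  have r: "(wu i j, wu j i) \<in> G3_rels" "(wv i j, wv j i) \<in> G3_rels" "(wp i j, wp j i) \<in> G3_rels"
     "(wu i j @ wu i j, []) \<in> G3_rels" "(wv i j @ wv i j, []) \<in> G3_rels"
     "(wp i j @ wp i j, []) \<in> G3_rels" if "ixn i < ixn j" for i j
    using that by (auto simp: G3_rels_def)
  have rz: "(wz i j k, wz k i j) \<in> G3_rels" "(wt i j k, wt k i j) \<in> G3_rels"
    "(wz i j k @ wz i j k, []) \<in> G3_rels" "(wt i j k @ wt i j k, []) \<in> G3_rels"
    if "distinct3 i j k" for i j k
    using that by (auto simp: G3_rels_def)
  note r' = r[THEN word_val_g3_rel]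
  have ne: "ixn i < ixn j \<or> ixn j < ixn i" if "i \<noteq> j" for i j
    using that by (cases i; cases j) auto
  \<comment> \<open>The presentation has these relations for \<open>i < j\<close> only; reading them
    backwards covers both orders.\<close>
  have s: "comm (g3_a i) (g3_a j) = comm (g3_a j) (g3_a i)"
    "comm (g3_b i) (g3_b j) = comm (g3_b j) (g3_b i)"
    "comm (g3_a i) (g3_b j) = comm (g3_a j) (g3_b i)"
    if "i \<noteq> j" for i j
    using ne[OF that] r'[of i j] r'[of j i] by (auto simp: w)
  have d: "comm (g3_a i) (g3_a j) + comm (g3_a i) (g3_a j) = 0"
    "comm (g3_b i) (g3_b j) + comm (g3_b i) (g3_b j) = 0"
    "comm (g3_a i) (g3_b j) + comm (g3_a i) (g3_b j) = 0"
    if "i \<noteq> j" for i j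
    using ne[OF that] r'[of i j] r'[of j i] s[OF that] by (auto simp: w)
  show ?thesis
    using ab[THEN word_val_g3_rel] rz[THEN word_val_g3_rel] c'
    by unfold_locales (simp_all add: w s d comm_eq_0_iff)
qed

interpretation g3: G3_system g3_a g3_b
  by (rule G3_system_g3)

lemma g3_nf: "\<exists>s. x = g3.nf s"
proof -
  have "\<exists>s. word_val (case_gen g3_a g3_b) w = g3.nf s" for w
  proof (induction w)
    case Nil
    then show ?case using g3.nf_0 by auto
  next
    case (Cons l w)
    obtain x e where l: "l = (x, e)" by force
    have "\<exists>m n. (if e then - case_gen g3_a g3_b x else case_gen g3_a g3_b x) = g3.E m n"
      by (cases x) (auto simp: g3.a_E g3.b_E g3.minus_E)
    with Cons show ?case
      by (auto simp: l g3.E_nf g3.nf_add)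
  qed
  then show ?thesis
    by (cases x rule: g3_cases) (simp add: abs_g3_word_val)
qed

text \<open>Evaluates a chosen representative; the choice is immaterial once \<open>f\<close> comes
  from a \<open>G3_system\<close>.\<close>

definition g3_ext :: "(gen \<Rightarrow> 'a::group_add) \<Rightarrow> g3 \<Rightarrow> 'a" where
  "g3_ext f x = word_val f (rep_g3 x)"

context G3_system
begin

lemma g3_ext_abs: "g3_ext (case_gen a b) (abs_g3 w) = word_val (case_gen a b) w"
  unfolding g3_ext_def
  by (rule word_val_cong) (metis Quotient_g3 Quotient_rep_abs Quotient_abs_rep G3_eqv.refl g3.abs_eq_iff)

lemma g3_ext_hom: "add_hom (g3_ext (case_gen a b))"
proof -
  have "g3_ext (case_gen a b) (x + y) = g3_ext (case_gen a b) x + g3_ext (case_gen a b) y" for x y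
    by (cases x rule: g3_cases; cases y rule: g3_cases) (simp add: plus_g3.abs_eq g3_ext_abs)
  then show ?thesis by (simp add: add_hom_def)
qed

lemma g3_ext_a: "g3_ext (case_gen a b) (g3_a i) = a i"
  and g3_ext_b: "g3_ext (case_gen a b) (g3_b i) = b i"
  by (simp_all add: g3_a_def g3_b_def g3_ext_abs) (simp_all add: wa_def wb_def)

end

lemma g3_hom_eqI:
  assumes "add_hom h" "add_hom k" "\<And>i. h (g3_a i) = k (g3_a i)" "\<And>i. h (g3_b i) = k (g3_b i)"
  shows "h = k"
proof
  fix x
  have *: "add_hom h \<Longrightarrow> h (word_val f w) = word_val (h \<circ> f) w" for h :: "g3 \<Rightarrow> 'a" and f w
    by (induction w) (auto simp: add_hom_0 add_hom_minus add_hom_def)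
  have "h \<circ> case_gen g3_a g3_b = k \<circ> case_gen g3_a g3_b"
    using assms(3,4) by (auto simp: fun_eq_iff split: gen.splits)
  then show "h x = k x"
    using *[OF assms(1)] *[OF assms(2)] by (cases x rule: g3_cases) (simp add: abs_g3_word_val)
qed

section \<open>The endomorphisms sigma and rho of the presented group\<close>

definition g3_sigma :: "g3 \<Rightarrow> g3" where "g3_sigma = g3_ext (case_gen g3_b g3_a)"
definition g3_rho :: "g3 \<Rightarrow> g3" where "g3_rho = g3_ext (case_gen g3_b g3.b')"

lemmas g3_sigma_hom = G3_system.g3_ext_hom[OF g3.swap_system, folded g3_sigma_def]
lemmas g3_sigma_a = G3_system.g3_ext_a[OF g3.swap_system, folded g3_sigma_def]
lemmas g3_sigma_b = G3_system.g3_ext_b[OF g3.swap_system, folded g3_sigma_def]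
lemmas g3_rho_hom = G3_system.g3_ext_hom[OF g3.rho_system, folded g3_rho_def]
lemmas g3_rho_a = G3_system.g3_ext_a[OF g3.rho_system, folded g3_rho_def]
lemmas g3_rho_b = G3_system.g3_ext_b[OF g3.rho_system, folded g3_rho_def]

lemma add_hom_comp: "add_hom h \<Longrightarrow> add_hom k \<Longrightarrow> add_hom (h \<circ> k)"
  by (simp add: add_hom_def)

lemma add_hom_id: "add_hom id"
  by (simp add: add_hom_def)

text \<open>Closes the cycle a_i, b_i, \<open>b' i\<close> under rho, whence its cube is the
  identity.\<close>

lemma g3_rho_b': "g3_rho (g3.b' i) = g3_a i"
  unfolding g3.b'_def using g3_rho_hom
  by (simp add: add_hom_def add_hom_minus[OF g3_rho_hom] g3_rho_a g3_rho_b g3.b'_def minus_add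
      del: add_uminus_conv_diff)

lemma g3_sigma_sigma: "g3_sigma \<circ> g3_sigma = id"
  by (rule g3_hom_eqI) (simp_all add: add_hom_comp add_hom_id g3_sigma_hom g3_sigma_a g3_sigma_b)

lemma g3_rho_cubed: "g3_rho \<circ> g3_rho \<circ> g3_rho = id"
  by (rule g3_hom_eqI) (simp_all add: add_hom_comp add_hom_id g3_rho_hom g3_rho_a g3_rho_b g3_rho_b')

text \<open>\<open>g3_rho \<circ> g3_sigma\<close> fixes b_i and exchanges a_i with
  \<open>b' i\<close>, hence is an involution.\<close>

lemma g3_rho_sigma_b': "g3_rho (g3_sigma (g3.b' i)) = g3_a i"
proof -
  have "g3_rho (g3_sigma (g3.b' i)) = g3_b i + g3_a i + - g3_b i"
    using g3_rho_hom g3_sigma_hom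
    by (simp add: g3.b'_def add_hom_def add_hom_minus[OF g3_rho_hom] add_hom_minus[OF g3_sigma_hom]
        g3_sigma_a g3_sigma_b g3_rho_a g3_rho_b minus_add flip: add.assoc del: add_uminus_conv_diff)
  also have "g3_b i + g3_a i = g3_a i + g3_b i"
    using g3.ab[of i] by (simp add: commutes_def)
  finally show ?thesis
    by (simp add: add.assoc)
qed

lemma g3_rho_sigma_squared: "g3_rho \<circ> g3_sigma \<circ> (g3_rho \<circ> g3_sigma) = id"
  by (rule g3_hom_eqI)
     (simp_all add: add_hom_comp add_hom_id g3_rho_hom g3_sigma_hom g3_rho_a g3_rho_b g3_sigma_a g3_sigma_b g3_rho_sigma_b')

lemma g3_a_neq_b: "g3_a i \<noteq> g3_b i"
proof -
  \<comment> \<open>The exponent sum in the \<open>a\<^sub>i\<close>.\<close>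
  interpret Z: G3_system "\<lambda>_. 1 :: int" "\<lambda>_. 0"
    by unfold_locales (simp_all add: commutes_def comm_def)
  show ?thesis
    using Z.g3_ext_a[of i] Z.g3_ext_b[of i] by auto
qed

lemma g3_triality:
  assumes "c = - x + g3_sigma x"
  shows "c + g3_rho c + g3_rho (g3_rho c) = 0"
proof -
  obtain s where "x = g3.nf s"
    using g3_nf by blast
  with g3.triality_nf[OF g3_sigma_hom g3_sigma_a g3_sigma_b g3_rho_hom g3_rho_a g3_rho_b, of c s] assms
  show ?thesis by simp
qed

section \<open>Recognising the symmetric group on three letters\<close>

locale S3_pair = group G for G (structure) +
  fixes r s
  assumes r [simp]: "r \<in> carrier G" and s [simp]: "s \<in> carrier G"
    and r_cubed: "r [^] (3::nat) = \<one>" and s_squared: "s [^] (2::nat) = \<one>"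
    and rs_squared: "(r \<otimes> s) [^] (2::nat) = \<one>"
    and r_neq: "r \<noteq> \<one>" and s_neq: "s \<noteq> \<one>"
begin

text \<open>Exponents are unrestricted and matter modulo 3 and 2, which keeps the multiplication
  rule free of reductions.\<close>

definition elt :: "nat \<Rightarrow> nat \<Rightarrow> 'a" where
  "elt i j = r [^] i \<otimes> s [^] j"

lemma elt_closed [simp]: "elt i j \<in> carrier G"
  by (simp add: elt_def)

lemma r_pow_mod: "r [^] (i mod 3) = r [^] (i :: nat)"
proof -
  have "r [^] i = r [^] (3 * (i div 3) + i mod 3)"
    by simp
  also have "\<dots> = r [^] (i mod 3)"
    by (simp only: r r_cubed nat_pow_one one_closed l_one nat_pow_closed flip: nat_pow_mult nat_pow_pow)
  finally show ?thesis ..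
qed

lemma s_pow_mod: "s [^] (i mod 2) = s [^] (i :: nat)"
proof -
  have "s [^] i = s [^] (2 * (i div 2) + i mod 2)"
    by simp
  also have "\<dots> = s [^] (i mod 2)"
    by (simp only: s s_squared nat_pow_one one_closed l_one nat_pow_closed flip: nat_pow_mult nat_pow_pow)
  finally show ?thesis ..
qed

lemma elt_mod: "elt (i mod 3) (j mod 2) = elt i j"
  by (simp add: elt_def r_pow_mod s_pow_mod)

text \<open>The relations give rsr = s, and the inverse of \<open>r\<close> is its square.\<close>

lemma s_r: "s \<otimes> r = r [^] (2::nat) \<otimes> s"
proof -
  have ss: "s \<otimes> s = \<one>" and rrr: "r \<otimes> (r \<otimes> r) = \<one>"
    using s_squared r_cubed by (simp_all add: numeral_2_eq_2 numeral_3_eq_3 m_assoc)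
  have "r \<otimes> (s \<otimes> r) = r \<otimes> (s \<otimes> r) \<otimes> (s \<otimes> s)"
    by (simp add: ss)
  also have "\<dots> = s"
    using rs_squared by (simp add: numeral_2_eq_2 m_assoc) (simp flip: m_assoc)
  finally have "r \<otimes> (s \<otimes> r) = r \<otimes> (r \<otimes> (r \<otimes> s))"
    using rrr by (simp flip: m_assoc)
  then show ?thesis
    by (simp add: numeral_2_eq_2 m_assoc)
qed

lemma s_r_pow: "s \<otimes> r [^] (k::nat) = r [^] (2 * k) \<otimes> s"
proof (induction k)
  case (Suc k)
  have "s \<otimes> r [^] Suc k = (s \<otimes> r [^] k) \<otimes> r"
    by (simp add: m_assoc)
  also have "\<dots> = r [^] (2 * k) \<otimes> (s \<otimes> r)"
    by (simp add: Suc m_assoc)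
  also have "\<dots> = r [^] (2 * k + 2) \<otimes> s"
    unfolding s_r by (simp only: r s m_assoc[symmetric] nat_pow_closed nat_pow_mult)
  finally show ?case by simp
qed simp

lemma s_pow_r_pow: "s [^] (j::nat) \<otimes> r [^] (k::nat) = r [^] (if even j then k else 2 * k) \<otimes> s [^] j"
proof (cases "even j")
  case True
  then have "s [^] j = \<one>"
    using s_pow_mod[of j] by simp
  with True show ?thesis by simp
next
  case False
  then have "s [^] j = s"
    using s_pow_mod[of j] by (simp add: odd_iff_mod_2_eq_one)
  with False show ?thesis by (simp add: s_r_pow)
qed

lemma elt_mult: "elt i j \<otimes> elt k l = elt (i + (if even j then k else 2 * k)) (j + l)"
proof -
  have "elt i j \<otimes> elt k l = r [^] i \<otimes> (s [^] j \<otimes> r [^] k) \<otimes> s [^] l"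
    by (simp add: elt_def m_assoc)
  also have "\<dots> = r [^] i \<otimes> r [^] (if even j then k else 2 * k) \<otimes> (s [^] j \<otimes> s [^] l)"
    unfolding s_pow_r_pow by (simp add: m_assoc)
  finally show ?thesis
    by (simp add: elt_def nat_pow_mult)
qed

text \<open>If rs or r^2 s were trivial, then r = s would have order dividing both 2 and 3.\<close>

lemma elt_eq_one:
  assumes "elt i j = \<one>"
  shows "i mod 3 = 0 \<and> j mod 2 = 0"
proof -
  have ss: "s \<otimes> s = \<one>" and rrr: "r \<otimes> (r \<otimes> r) = \<one>"
    using s_squared r_cubed by (simp_all add: numeral_2_eq_2 numeral_3_eq_3 m_assoc)
  have rr: "r \<otimes> r \<noteq> \<one>"
    using rrr r_neq by auto
  have rs: "r \<noteq> s"
    using ss rr by auto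
  have e: "r [^] (i mod 3) \<otimes> s [^] (j mod 2) = \<one>"
    using assms elt_mod[of i j] by (simp add: elt_def)
  have 1: "r \<otimes> s \<noteq> \<one>"
  proof
    assume "r \<otimes> s = \<one>"
    then have "r \<otimes> s = s \<otimes> s" by (simp add: ss)
    then show False using rs by simp
  qed
  have 2: "r \<otimes> r \<otimes> s \<noteq> \<one>"
  proof
    assume "r \<otimes> r \<otimes> s = \<one>"
    then have "r \<otimes> (r \<otimes> (r \<otimes> s)) = r" by (simp add: m_assoc)
    then have "s = r" using rrr by (simp flip: m_assoc)
    then show False using rs by simp
  qed
  have "i mod 3 \<in> {0, 1, 2}" "j mod 2 \<in> {0, 1}" by auto
  then show ?thesis
    using e 1 2 rr r_neq s_neq by (auto simp: numeral_2_eq_2)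
qed

lemma elt_eq_iff: "elt i j = elt k l \<longleftrightarrow> i mod 3 = k mod 3 \<and> j mod 2 = l mod 2"
proof
  assume "elt i j = elt k l"
  \<comment> \<open>Multiplying by the inverses of \<open>r [^] k\<close> and \<open>s [^] l\<close>
    reduces the claim to \<open>elt_eq_one\<close>.\<close>
  then have "elt (2 * k) 0 \<otimes> elt i j \<otimes> elt 0 l = elt (2 * k) 0 \<otimes> elt k l \<otimes> elt 0 l"
    by simp
  then have "elt (2 * k + i) (j + l) = elt (3 * k) (2 * l)"
    by (simp add: elt_mult mult_2 numeral_3_eq_3 add.assoc if_distrib cong: if_cong)
  also have "\<dots> = elt 0 0"
    using elt_mod[of "3 * k" "2 * l"] by simp
  finally have "(2 * k + i) mod 3 = 0 \<and> (j + l) mod 2 = 0"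
    using elt_eq_one[of "2 * k + i" "j + l"] by (simp add: elt_def)
  then show "i mod 3 = k mod 3 \<and> j mod 2 = l mod 2"
    by presburger
next
  assume "i mod 3 = k mod 3 \<and> j mod 2 = l mod 2"
  then show "elt i j = elt k l"
    using elt_mod[of i j] elt_mod[of k l] by simp
qed

lemma generate_eq: "generate G {r, s} = range (case_prod elt)"
proof
  have rs: "r = elt 1 0" "s = elt 0 1" "\<one> = elt 0 0"
    by (simp_all add: elt_def)
  show "generate G {r, s} \<subseteq> range (case_prod elt)"
  proof
    fix x assume "x \<in> generate G {r, s}"
    then show "x \<in> range (case_prod elt)"
    proof induction
      case one
      have "\<one> = case_prod elt (0, 0)" using rs by simp
      then show ?case by blast
    next
      case (incl h)
      then have "h = case_prod elt (1, 0) \<or> h = case_prod elt (0, 1)" using rs by auto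
      then show ?case by blast
    next
      case (inv h)
      have "inv r = elt 2 0"
        using r_cubed by (intro inv_equality) (simp_all add: elt_def numeral_2_eq_2 numeral_3_eq_3)
      moreover have "inv s = elt 0 1"
        using s_squared by (intro inv_equality) (simp_all add: elt_def numeral_2_eq_2)
      ultimately have "inv h = case_prod elt (2, 0) \<or> inv h = case_prod elt (0, 1)"
        using inv by auto
      then show ?case by blast
    next
      case (eng h1 h2)
      then obtain i j k l where "h1 = elt i j" "h2 = elt k l" by auto
      then have "h1 \<otimes> h2 = case_prod elt (i + (if even j then k else 2 * k), j + l)"
        by (simp add: elt_mult)
      then show ?case by blast
    qed
  qed
  have pow: "x [^] (n::nat) \<in> generate G {r, s}" if "x \<in> {r, s}" for x n
    using that by (induction n) (auto intro: generate.intros)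
  then show "range (case_prod elt) \<subseteq> generate G {r, s}"
    by (auto simp: elt_def intro!: generate.eng pow)
qed

end

lemma S3_pair_iso:
  assumes "S3_pair G r s" "S3_pair H r' s'"
  shows "subgroup_generated G {r, s} \<cong> subgroup_generated H {r', s'}"
proof -
  interpret G: S3_pair G r s by fact
  interpret H: S3_pair H r' s' by fact
  \<comment> \<open>Some exponents of \<open>x\<close> are chosen; by \<open>elt_eq_iff\<close> in
    both groups the value does not depend on the choice.\<close>
  define f where "f x = (case (SOME p. x = case_prod G.elt p) of (i, j) \<Rightarrow> H.elt i j)" for x
  have f: "f (G.elt i j) = H.elt i j" for i j
  proof -
    have "G.elt i j = case_prod G.elt (SOME p. G.elt i j = case_prod G.elt p)"
      by (rule someI[of _ "(i, j)"]) simp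
    then show ?thesis
      by (auto simp: f_def G.elt_eq_iff H.elt_eq_iff split: prod.splits)
  qed
  have carr: "carrier (subgroup_generated G {r, s}) = range (case_prod G.elt)"
    "carrier (subgroup_generated H {r', s'}) = range (case_prod H.elt)"
    by (simp_all add: carrier_subgroup_generated G.generate_eq H.generate_eq Int_absorb1)
  have range_elt: "H.elt i j \<in> range (case_prod H.elt)" for i j
    by (rule range_eqI[of _ _ "(i, j)"]) simp
  have "f \<in> iso (subgroup_generated G {r, s}) (subgroup_generated H {r', s'})"
  proof (rule isoI)
    show "f \<in> hom (subgroup_generated G {r, s}) (subgroup_generated H {r', s'})"
      by (rule homI) (auto simp: carr f G.elt_mult H.elt_mult range_elt)
    show "bij_betw f (carrier (subgroup_generated G {r, s})) (carrier (subgroup_generated H {r', s'}))"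
      unfolding carr
      by (rule bij_betwI') (auto simp: f G.elt_eq_iff H.elt_eq_iff range_elt)
  qed
  then show ?thesis by (rule is_isoI)
qed

lemma S3_pair_sym_group:
  assumes "S3_pair G r s"
  shows "subgroup_generated G {r, s} \<cong> sym_group 3"
proof -
  define s' where "s' = transpose (1::nat) 2"
  \<comment> \<open>Composed from right to left, this is the three-cycle 1, 2, 3.\<close>
  define r' where "r' = transpose (1::nat) 2 \<circ> transpose 2 3"
  have perm: "r' permutes {1..3}" "s' permutes {1..3}"
    unfolding r'_def s'_def by (auto intro!: permutes_compose permutes_swap_id)
  interpret S: group "sym_group 3" by (rule sym_group_is_group)
  interpret S: S3_pair "sym_group 3" r' s'
  proof unfold_locales
    show "r' \<in> carrier (sym_group 3)" "s' \<in> carrier (sym_group 3)"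
      using perm by (simp_all add: sym_group_carrier)
    show "r' [^]\<^bsub>sym_group 3\<^esub> (3::nat) = \<one>\<^bsub>sym_group 3\<^esub>"
      "s' [^]\<^bsub>sym_group 3\<^esub> (2::nat) = \<one>\<^bsub>sym_group 3\<^esub>"
      "(r' \<otimes>\<^bsub>sym_group 3\<^esub> s') [^]\<^bsub>sym_group 3\<^esub> (2::nat) = \<one>\<^bsub>sym_group 3\<^esub>"
      by (simp_all add: numeral_2_eq_2 numeral_3_eq_3 sym_group_one sym_group_mult)
         (auto simp: fun_eq_iff r'_def s'_def transpose_def)
    show "r' \<noteq> \<one>\<^bsub>sym_group 3\<^esub>" "s' \<noteq> \<one>\<^bsub>sym_group 3\<^esub>"
      by (auto simp: sym_group_one fun_eq_iff r'_def s'_def transpose_def)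
  qed
  \<comment> \<open>Six inequivalent pairs of exponents give six permutations, and there are only 3!
    = 6.\<close>
  have "carrier (sym_group 3) = range (case_prod S.elt)"
  proof (rule card_seteq[symmetric])
    show "finite (carrier (sym_group 3))"
      by (simp add: sym_group_def finite_permutations)
    have "inj_on (case_prod S.elt) ({..<3} \<times> {..<2})"
      by (auto simp: inj_on_def S.elt_eq_iff)
    then have "6 = card (case_prod S.elt ` ({..<3} \<times> {..<2}))"
      by (simp add: card_image)
    also have "\<dots> \<le> card (range (case_prod S.elt))"
    proof (rule card_mono)
      have "range (case_prod S.elt) \<subseteq> carrier (sym_group 3)"
        by auto
      then show "finite (range (case_prod S.elt))"
        by (rule finite_subset) (simp add: sym_group_def finite_permutations)
    qed auto
    finally show "card (carrier (sym_group 3)) \<le> card (range (case_prod S.elt))"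
      by (simp add: sym_group_card_carrier fact_numeral)
  qed auto
  then have "generate (sym_group 3) {r', s'} = carrier (sym_group 3)"
    by (simp only: S.generate_eq)
  then have "subgroup_generated (sym_group 3) {r', s'} = sym_group 3"
    by (simp add: subgroup_generated_def Int_absorb1)
  then show ?thesis
    using S3_pair_iso[OF assms S.S3_pair_axioms] by simp
qed

section \<open>Transport to the group of word classes\<close>

lift_definition g3_class :: "g3 \<Rightarrow> word set" is G3_class
  unfolding G3_class_def by (blast intro: G3_eqv.sym G3_eqv.trans)

lemma G3_class_eq_iff: "G3_class u = G3_class v \<longleftrightarrow> G3_eqv u v"
  unfolding G3_class_def by (blast intro: G3_eqv.refl G3_eqv.sym G3_eqv.trans)

lemma G3_class_eq: "G3_class w = g3_class (abs_g3 w)"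
  by (simp add: g3_class.abs_eq)

lemma inj_g3_class: "inj g3_class"
  by (rule injI, transfer) (simp add: G3_class_eq_iff)

lemma carrier_G3: "carrier G3 = range g3_class"
proof -
  have "g3_class x \<in> range G3_class" for x
    by (cases x rule: g3_cases) (simp flip: G3_class_eq)
  then show ?thesis
    by (auto simp: G3_def G3_class_eq)
qed

lemma g3_class_closed [simp]: "g3_class x \<in> carrier G3"
  by (simp add: carrier_G3)

lemma G3_one: "\<one>\<^bsub>G3\<^esub> = g3_class 0"
  by (simp add: G3_def G3_class_eq zero_g3_def)

lemma G3_mult: "g3_class x \<otimes>\<^bsub>G3\<^esub> g3_class y = g3_class (x + y)"
proof -
  obtain u v where x: "x = abs_g3 u" and y: "y = abs_g3 v"
    by (metis g3_cases)
  let ?R = "\<lambda>r. \<exists>p\<in>G3_class u. \<exists>q\<in>G3_class v. r = p @ q"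
  have "?R (u @ v)"
    by (auto simp: G3_class_def intro: G3_eqv.refl)
  \<comment> \<open>\<open>G3_mult\<close> chooses an arbitrary product of representatives; each
    such product is equivalent to \<open>u @ v\<close>.\<close>
  then have "?R (SOME r. ?R r)"
    by (rule someI)
  then have "G3_eqv (u @ v) (SOME r. ?R r)"
    by (auto simp: G3_class_def intro: G3_eqv_append2)
  then have "G3_class (SOME r. ?R r) = G3_class (u @ v)"
    by (simp add: G3_class_eq_iff G3_eqv.sym)
  then show ?thesis
    by (simp add: x y G3_def G3_mult_def plus_g3.abs_eq flip: G3_class_eq)
qed

lemma group_G3: "group G3"
proof (rule groupI)
  fix x y z
  assume "x \<in> carrier G3" "y \<in> carrier G3" "z \<in> carrier G3"
  then show "x \<otimes>\<^bsub>G3\<^esub> y \<otimes>\<^bsub>G3\<^esub> z = x \<otimes>\<^bsub>G3\<^esub> (y \<otimes>\<^bsub>G3\<^esub> z)"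
    by (auto simp: carrier_G3 G3_mult add.assoc)
next
  fix x assume "x \<in> carrier G3"
  then obtain w where w: "x = g3_class w" by (auto simp: carrier_G3)
  show "\<exists>y\<in>carrier G3. y \<otimes>\<^bsub>G3\<^esub> x = \<one>\<^bsub>G3\<^esub>"
    by (rule bexI[of _ "g3_class (- w)"]) (simp_all add: w G3_mult G3_one)
qed (auto simp: carrier_G3 G3_mult G3_one)

lemma G3_inv: "inv\<^bsub>G3\<^esub> (g3_class x) = g3_class (- x)"
  by (rule group.inv_equality[OF group_G3]) (simp_all add: G3_mult G3_one)

text \<open>Restricted to the carrier because members of \<open>auto G3\<close> must be
  extensional.\<close>

definition g3_lift :: "(g3 \<Rightarrow> g3) \<Rightarrow> word set \<Rightarrow> word set" where
  "g3_lift h = (\<lambda>C\<in>carrier G3. g3_class (h (inv_into UNIV g3_class C)))"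

lemma g3_lift_class [simp]: "g3_lift h (g3_class x) = g3_class (h x)"
  by (simp add: g3_lift_def inv_f_f[OF inj_g3_class])

lemma g3_lift_inj: "g3_lift h = g3_lift k \<Longrightarrow> h = k"
  by (metis g3_lift_class inj_g3_class injD ext)

lemma g3_lift_auto:
  assumes "add_hom h" "bij h"
  shows "g3_lift h \<in> auto G3"
proof -
  have "g3_lift h \<in> hom G3 G3"
    using assms(1) by (intro homI) (auto simp: carrier_G3 G3_mult add_hom_def)
  moreover have "bij_betw (g3_lift h) (carrier G3) (carrier G3)"
    using bij_is_surj[OF assms(2)] bij_is_inj[OF assms(2)] inj_g3_class unfolding carrier_G3
    by (intro bij_betwI') (auto simp: inj_eq, metis surjD)
  moreover have "g3_lift h \<in> extensional (carrier G3)"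
    by (simp add: g3_lift_def)
  ultimately show ?thesis
    by (simp add: auto_def Bij_def)
qed

lemma AutoGroup_G3_one: "\<one>\<^bsub>AutoGroup G3\<^esub> = g3_lift id"
  by (auto simp: AutoGroup_def BijGroup_def carrier_G3 g3_lift_def inv_f_f[OF inj_g3_class]
      restrict_def fun_eq_iff)

lemma AutoGroup_G3_mult:
  assumes "g3_lift h \<in> auto G3" "g3_lift k \<in> auto G3"
  shows "g3_lift h \<otimes>\<^bsub>AutoGroup G3\<^esub> g3_lift k = g3_lift (h \<circ> k)"
proof -
  have "compose (carrier G3) (g3_lift h) (g3_lift k) = g3_lift (h \<circ> k)"
    by (auto simp: compose_def fun_eq_iff g3_lift_def carrier_G3 inv_f_f[OF inj_g3_class])
  with assms show ?thesis
    by (simp add: AutoGroup_def BijGroup_def auto_def)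
qed

lemma bij_g3_sigma: "bij g3_sigma"
  using g3_sigma_sigma by (auto intro: o_bij)

lemma bij_g3_rho: "bij g3_rho"
  using g3_rho_cubed by (auto intro: o_bij[of "g3_rho \<circ> g3_rho"] simp: comp_assoc)

lemma S3_pair_G3: "S3_pair (AutoGroup G3) (g3_lift g3_rho) (g3_lift g3_sigma)"
proof -
  interpret A: group "AutoGroup G3"
    by (rule group.AutoGroup[OF group_G3])
  have \<sigma>: "g3_lift g3_sigma \<in> auto G3" and \<rho>: "g3_lift g3_rho \<in> auto G3"
    by (simp_all add: g3_lift_auto g3_sigma_hom bij_g3_sigma g3_rho_hom bij_g3_rho)
  have auto_comp: "g3_lift (h \<circ> k) \<in> auto G3" if "add_hom h" "bij h" "add_hom k" "bij k" for h k
    using that by (simp add: g3_lift_auto add_hom_comp bij_comp)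
  have carr: "carrier (AutoGroup G3) = auto G3"
    by (simp add: AutoGroup_def)
  \<comment> \<open>Both automorphisms send a_i to b_i, which differs from a_i.\<close>
  have neq: "h \<noteq> id" if "\<And>i. h (g3_a i) = g3_b i" for h :: "g3 \<Rightarrow> g3"
    using that g3_a_neq_b by (metis id_apply)
  show ?thesis
  proof unfold_locales
    show "g3_lift g3_rho \<in> carrier (AutoGroup G3)" "g3_lift g3_sigma \<in> carrier (AutoGroup G3)"
      using \<sigma> \<rho> by (simp_all add: carr)
    show "g3_lift g3_rho [^]\<^bsub>AutoGroup G3\<^esub> (3::nat) = \<one>\<^bsub>AutoGroup G3\<^esub>"
      "g3_lift g3_sigma [^]\<^bsub>AutoGroup G3\<^esub> (2::nat) = \<one>\<^bsub>AutoGroup G3\<^esub>"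
      "(g3_lift g3_rho \<otimes>\<^bsub>AutoGroup G3\<^esub> g3_lift g3_sigma) [^]\<^bsub>AutoGroup G3\<^esub> (2::nat) = \<one>\<^bsub>AutoGroup G3\<^esub>"
      using \<sigma> \<rho>
      by (simp_all add: numeral_2_eq_2 numeral_3_eq_3 carr AutoGroup_G3_mult auto_comp g3_sigma_hom
          bij_g3_sigma g3_rho_hom bij_g3_rho g3_sigma_sigma g3_rho_cubed g3_rho_sigma_squared
          flip: AutoGroup_G3_one)
    show "g3_lift g3_rho \<noteq> \<one>\<^bsub>AutoGroup G3\<^esub>" "g3_lift g3_sigma \<noteq> \<one>\<^bsub>AutoGroup G3\<^esub>"
      using neq[of g3_rho] neq[of g3_sigma] unfolding AutoGroup_G3_one
      by (auto dest!: g3_lift_inj simp: g3_sigma_a g3_rho_a)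
  qed
qed

lemma group_with_triality_G3: "group_with_triality G3 (g3_lift g3_sigma) (g3_lift g3_rho)"
proof -
  interpret S: S3_pair "AutoGroup G3" "g3_lift g3_rho" "g3_lift g3_sigma"
    by (rule S3_pair_G3)
  have "subgroup_generated (AutoGroup G3) {g3_lift g3_sigma, g3_lift g3_rho} \<cong> sym_group 3"
    using S3_pair_sym_group[OF S3_pair_G3] by (simp add: insert_commute)
  moreover have "let c = inv\<^bsub>G3\<^esub> g \<otimes>\<^bsub>G3\<^esub> g3_lift g3_sigma g in
      c \<otimes>\<^bsub>G3\<^esub> g3_lift g3_rho c \<otimes>\<^bsub>G3\<^esub> g3_lift g3_rho (g3_lift g3_rho c) = \<one>\<^bsub>G3\<^esub>"
    if "g \<in> carrier G3" for g
    using that g3_triality[OF HOL.refl]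
    by (auto simp: carrier_G3 Let_def G3_inv G3_mult G3_one)
  ultimately show ?thesis
    unfolding group_with_triality_def
    using group_G3 S.r_cubed S.s_squared S.rs_squared
    by (auto simp: g3_lift_auto g3_sigma_hom bij_g3_sigma g3_rho_hom bij_g3_rho)
qed

section \<open>The prescribed values on word classes\<close>

lemma G3_class_words:
  "ga i = g3_class (g3_a i)" "gb i = g3_class (g3_b i)"
  "gu i j = g3_class (comm (g3_a i) (g3_a j))" "gv i j = g3_class (comm (g3_b i) (g3_b j))"
  "gp i j = g3_class (comm (g3_a i) (g3_b j))"
  "gz i j k = g3_class (comm (comm (g3_a i) (g3_b j)) (g3_a k))"
  "gt i j k = g3_class (comm (comm (g3_a i) (g3_b j)) (g3_b k))"
  by (simp_all add: G3_class_eq abs_g3_word_val wu_def wv_def wp_def wz_def wt_def)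
     (simp_all add: wa_def wb_def)

theorem theorem2p14:
  shows "\<exists>\<sigma> \<rho>. \<sigma> \<in> auto G3 \<and> \<rho> \<in> auto G3 \<and>
     (\<forall>i. \<sigma> (ga i) = gb i \<and> \<sigma> (gb i) = ga i) \<and>
     (\<forall>i j. ixn i < ixn j \<longrightarrow> \<sigma> (gu i j) = gv i j \<and> \<sigma> (gv i j) = gu i j \<and> \<sigma> (gp i j) = gp i j) \<and>
     \<sigma> (gz X1 X2 X3) = gt X1 X2 X3 \<and> \<sigma> (gt X1 X2 X3) = gz X1 X2 X3 \<and>
     (\<forall>i. \<rho> (ga i) = gb i \<and>
          \<rho> (gb i) = inv\<^bsub>G3\<^esub> (ga i) \<otimes>\<^bsub>G3\<^esub> inv\<^bsub>G3\<^esub> (gb i)) \<and>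
     (\<forall>i j. ixn i < ixn j \<longrightarrow> \<rho> (gu i j) = gv i j \<and>
          \<rho> (gv i j) = gu i j \<otimes>\<^bsub>G3\<^esub> gv i j \<and>
          \<rho> (gp i j) = gv i j \<otimes>\<^bsub>G3\<^esub> gp i j) \<and>
     \<rho> (gz X1 X2 X3) = gt X1 X2 X3 \<and>
     \<rho> (gt X1 X2 X3) = gz X1 X2 X3 \<otimes>\<^bsub>G3\<^esub> gt X1 X2 X3 \<and>
     group_with_triality G3 \<sigma> \<rho>"
proof -
  have g3_sigma_comm: "g3_sigma (comm x y) = comm (g3_sigma x) (g3_sigma y)"
    and g3_rho_comm: "g3_rho (comm x y) = comm (g3_rho x) (g3_rho y)" for x y
    by (simp_all add: add_hom_comm g3_sigma_hom g3_rho_hom)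
  have lt: "i \<noteq> j" if "ixn i < ixn j" for i j
    using that by auto
  have b': "g3.b' i = - g3_a i + - g3_b i" for i
    by (rule g3.b'_def)
  have "g3_rho (comm (g3_b i) (g3_b j)) = comm (g3_a i) (g3_a j) + comm (g3_b i) (g3_b j)"
    "g3_rho (comm (g3_a i) (g3_b j)) = comm (g3_b i) (g3_b j) + comm (g3_a i) (g3_b j)"
    if "i \<noteq> j" for i j
    unfolding g3_rho_comm g3_rho_a g3_rho_b g3.comm_b'_b'[OF that] g3.comm_b_b'[OF that]
    by (simp_all only: g3.comm_a_a[OF that] g3.comm_b_b[OF that] g3.comm_a_b[OF that])
  moreover have "g3_rho (comm (g3_a i) (g3_a j)) = comm (g3_b i) (g3_b j)" for i j
    by (simp only: g3_rho_comm g3_rho_a)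
  ultimately have g3_rho_uvp:
    "g3_rho (comm (g3_a i) (g3_a j)) = comm (g3_b i) (g3_b j)"
    "g3_rho (comm (g3_b i) (g3_b j)) = comm (g3_a i) (g3_a j) + comm (g3_b i) (g3_b j)"
    "g3_rho (comm (g3_a i) (g3_b j)) = comm (g3_b i) (g3_b j) + comm (g3_a i) (g3_b j)"
    if "i \<noteq> j" for i j
    using that by blast+
  \<comment> \<open>\<open>LZ\<close> and \<open>LT\<close> are defined through p_23; z_123 and
    t_123 are expressed through p_12.\<close>
  have Z: "comm (comm (g3_a X1) (g3_b X2)) (g3_a X3) = g3.val LZ"
    and T: "comm (comm (g3_a X1) (g3_b X2)) (g3_b X3) = g3.val LT"
    using g3.comm_P_a[of X3] g3.comm_P_b[of X3] by simp_all
  have P: "comm (g3_b X1) (g3.b' X2) = g3.val (LV X3) + g3.val (LP X3)"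
    using g3.comm_b_b'[of X1 X2] by simp
  have g3_rho_Z: "g3_rho (comm (comm (g3_a X1) (g3_b X2)) (g3_a X3)) = comm (comm (g3_a X1) (g3_b X2)) (g3_b X3)"
    and g3_rho_T: "g3_rho (comm (comm (g3_a X1) (g3_b X2)) (g3_b X3)) =
      comm (comm (g3_a X1) (g3_b X2)) (g3_a X3) + comm (comm (g3_a X1) (g3_b X2)) (g3_b X3)"
    unfolding g3_rho_comm g3_rho_a g3_rho_b P g3.comm_VP_b g3.comm_VP_b'
    by (simp_all only: Z T)
  show ?thesis
    using group_with_triality_G3 g3_rho_Z g3_rho_T
    by - (rule exI[of _ "g3_lift g3_sigma"], rule exI[of _ "g3_lift g3_rho"],
        simp add: G3_class_words G3_inv G3_mult g3_lift_auto g3_sigma_hom bij_g3_sigma g3_rho_hom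
          bij_g3_rho g3_sigma_comm g3_sigma_a g3_sigma_b g3_rho_a g3_rho_b g3_rho_uvp lt g3.comm_b_a b')
qed

end
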